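(* Let $G$ be a finite group such that exactly two elements of $cs(G)$ are composite numbers. Then $G$ is not an almost simple group.
   Context: All groups are finite. For a group $G$ and $x\in G$, $x^G$ denotes the conjugacy class of $x$ in $G$, and $cs(G)=\{|x^G| : x\in G\}$ is the set of all conjugacy class sizes of $G$ (a set, without multiplicities). A composite number is a positive integer that has at least one positive divisor different from $1$ and itself. A group $G$ is almost simple if there is a non-abelian simple group $S$ such that $G$ is isomorphic to a group $K$ with $\mathrm{Inn}(S)\leq K\leq \mathrm{Aut}(S)$. *)

theory Defs
  imports "HOL-Algebra.Algebra"
begin

definition composite :: "nat \<Rightarrow> bool"
  where "composite n \<longleftrightarrow> n > 0 \<and> (\<exists>d. d dvd n \<and> d \<noteq> 1 \<and> d \<noteq> n)"

text \<open>Restricted to the carrier, as membership in \<^const>\<open>auto\<close> requires extensional functions; this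
  is also the form of the conjugation action in \<^theory>\<open>HOL-Algebra.Group_Action\<close>.\<close>

definition conj_by :: "('a, 'm) monoid_scheme \<Rightarrow> 'a \<Rightarrow> 'a \<Rightarrow> 'a"
  where "conj_by G g = (\<lambda>x \<in> carrier G. g \<otimes>\<^bsub>G\<^esub> x \<otimes>\<^bsub>G\<^esub> inv\<^bsub>G\<^esub> g)"

definition conj_class :: "('a, 'm) monoid_scheme \<Rightarrow> 'a \<Rightarrow> 'a set"
  where "conj_class G x = orbit G (conj_by G) x"

definition cs :: "('a, 'm) monoid_scheme \<Rightarrow> nat set"
  where "cs G = {card (conj_class G x) | x. x \<in> carrier G}"

definition Inn :: "('a, 'm) monoid_scheme \<Rightarrow> ('a \<Rightarrow> 'a) set"
  where "Inn S = conj_by S ` carrier S"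

text \<open>HOL cannot quantify over the type in which the simple group lives, so that type is a
  parameter. A statement that \<open>G\<close> is not almost simple must leave it arbitrary.\<close>

definition almost_simple :: "'b itself \<Rightarrow> ('a, 'm) monoid_scheme \<Rightarrow> bool"
  where "almost_simple ty G \<longleftrightarrow>
    (\<exists>(S :: 'b monoid) K. simple_group S \<and> finite (carrier S) \<and> \<not> comm_group S \<and>
       subgroup K (AutoGroup S) \<and> Inn S \<subseteq> K \<and>
       G \<cong> (AutoGroup S)\<lparr>carrier := K\<rparr>)"

end

theory Submission
  imports Defs "HOL-Computational_Algebra.Polynomial"
begin

text \<open>If two classes \<open>x\<^sup>G\<close>, \<open>y\<^sup>G\<close> of an almost simple group have coprime sizes, then
  \<open>x\<^sup>G y\<^sup>G\<close> is a single class, larger than both. When no class size is prime, the class equation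
  makes the two composite sizes coprime, and this class has a third size.

  When a class \<open>x\<^sup>G\<close> has prime size \<open>p\<close>, the group acts faithfully on it, an element \<open>y\<close> of order
  \<open>p\<close> generates its own centralizer, and the composite sizes are \<open>|y\<^sup>G| = |G| / p\<close> and
  \<open>|(xy)\<^sup>G| > |G| / p\<close>. By Burnside's theorem the action is 2-transitive, for otherwise the Sylow
  \<open>p\<close>-subgroup would be normal. The restriction on class sizes then forces the elements whose
  centralizer is a point stabilizer, together with 1, to be closed under products. They form a
  normal subgroup of order prime to \<open>p\<close>, which is impossible in a faithful transitive group of
  degree \<open>p\<close>.\<close>

text \<open>Almost simplicity enters through one property: two nontrivial normal subgroups never
  commute elementwise. Hence the group acts faithfully on every nontrivial class. This makes
  \<open>p\<close> the least nontrivial class size, so that no second prime size exists, and it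
  keeps \<open>P\<close> from being normal. If |y^G| and |(xy)^G| are the only composite sizes, then
  below |y^G| only the sizes 1 and \<open>p\<close> occur. The obstacle is to exploit this gap.
  Double transitivity gives |y^G| = (p - 1)|W| for the stabilizer \<open>W\<close> of two points and
  lets any two distinct points be moved to a standard pair. The number e of conjugates of
  \<open>y\<close> in \<open>P\<close> divides p - 1 and is congruent to |y^G| modulo
  \<open>p\<close>, so \<open>p\<close> divides |W| + e. A product of two elements whose
  centralizers are the stabilizers of distinct points has a centralizer properly containing a
  two-point stabilizer. If the class of this product did not have size \<open>p\<close>, that
  centralizer would have order at most \<open>p\<close>, which forces |W| = 1, against |y^G| >
  p.\<close>

hide_const (open) Divisibility.prime UnivPoly.coeff UnivPoly.monom Coset.order

section \<open>Permutations of prime degree\<close>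

text \<open>Turns a congruence of polynomial functions into one of coefficients. Induction splits
  off the linear factor at the last node; the quotient vanishes modulo \<open>p\<close> at the other
  nodes because node differences are nonzero and smaller than \<open>p\<close>.\<close>

lemma dvd_coeffs_if_dvd_values:
  fixes p :: int and Q :: "int poly"
  assumes "prime p" "degree Q \<le> n" "int n < p" "\<And>i. i \<le> n \<Longrightarrow> p dvd poly Q (int i)"
  shows "p dvd coeff Q k"
  using assms(2-)
proof (induction n arbitrary: Q k)
  case 0
  then obtain a where "Q = [:a:]" using degree_0_id by (metis le_zero_eq)
  then show ?case using 0(3)[of 0] by (auto simp: coeff_pCons split: nat.split)
next
  case (Suc n)
  define R where "R = synthetic_div Q (int (Suc n))"
  have Q: "Q = [:- int (Suc n), 1:] * R + [:poly Q (int (Suc n)):]"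
    unfolding R_def by (simp only: synthetic_div_correct')
  have dR: "degree R \<le> n" using Suc.prems(1) by (simp add: R_def degree_synthetic_div)
  have "p dvd poly R (int i)" if "i \<le> n" for i
  proof -
    have "poly Q (int i) - poly Q (int (Suc n)) = (int i - int (Suc n)) * poly R (int i)"
      by (subst (1) Q) (simp add: algebra_simps)
    then have "p dvd (int i - int (Suc n)) * poly R (int i)"
      using Suc.prems(3)[of i] Suc.prems(3)[of "Suc n"] that by (metis dvd_diff le_SucI order_refl)
    moreover have "\<not> p dvd int i - int (Suc n)"
    proof
      assume "p dvd int i - int (Suc n)"
      then have "p dvd int (Suc n) - int i" by (simp add: dvd_diff_commute)
      then have "p \<le> int (Suc n) - int i" using that by (intro zdvd_imp_le) auto
      then show False using Suc.prems(2) by simp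
    qed
    ultimately show ?thesis using assms(1) prime_dvd_mult_iff by blast
  qed
  then have "p dvd coeff R k" for k
    using Suc.IH[OF dR] Suc.prems(2) by simp
  then have "[:p:] dvd R" by (simp add: const_poly_dvd_iff)
  moreover have "[:p:] dvd [:poly Q (int (Suc n)):]"
    using Suc.prems(3)[of "Suc n"] by (auto simp: const_poly_dvd_iff coeff_pCons split: nat.split)
  ultimately have "[:p:] dvd Q" by (subst Q) (meson dvd_add dvd_mult)
  then show ?case by (simp add: const_poly_dvd_iff)
qed

lemma poly_cong_arg:
  fixes p :: int
  shows "p dvd a - b \<Longrightarrow> p dvd poly Q a - poly Q b"
proof (induction Q)
  case (pCons c Q)
  have "poly (pCons c Q) a - poly (pCons c Q) b = a * (poly Q a - poly Q b) + (a - b) * poly Q b"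
    by (simp add: algebra_simps)
  then show ?case using pCons by simp
qed simp

text \<open>Newton interpolation: a new node is met by adding a multiple of the product
  \<open>E\<close> of the linear factors at the earlier nodes, whose value at the new node is
  invertible modulo \<open>p\<close>.\<close>

lemma interpolation_mod_prime:
  fixes p :: int and f :: "int \<Rightarrow> int"
  assumes "prime p" "int k \<le> p"
  shows "\<exists>F :: int poly. degree F \<le> k - 1 \<and> (\<forall>i<k. p dvd poly F (int i) - f (int i))"
  using assms(2)
proof (induction k)
  case 0
  then show ?case by (intro exI[of _ 0]) auto
next
  case (Suc k)
  then obtain F where F: "degree F \<le> k - 1" "\<And>i. i < k \<Longrightarrow> p dvd poly F (int i) - f (int i)"
    by auto
  define E where "E = (\<Prod>i<k. [:- int i, 1:])"
  have dE: "degree E = k" unfolding E_def by (subst degree_prod_eq_sum_degree) auto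
  have E0: "poly E (int i) = 0" if "i < k" for i
    using that by (auto simp: E_def poly_prod)
  have "\<not> p dvd poly E (int k)"
  proof
    assume "p dvd poly E (int k)"
    then have "p dvd (\<Prod>i<k. int k - int i)" by (simp add: E_def poly_prod)
    then obtain i where i: "i < k" "p dvd int k - int i"
      unfolding prime_dvd_prod_iff[OF finite_lessThan assms(1)] by auto
    then have "p \<le> int k - int i" by (intro zdvd_imp_le) auto
    then show False using Suc.prems by simp
  qed
  then have "coprime (poly E (int k)) p"
    using assms(1) by (simp add: coprime_commute prime_imp_coprime)
  then obtain u v where uv: "u * poly E (int k) + v * p = 1"
    by (metis bezout_int coprime_imp_gcd_eq_1)
  define c where "c = u * (f (int k) - poly F (int k))"
  have "poly (F + smult c E) (int k) - f (int k)
      = (poly F (int k) - f (int k)) * (1 - u * poly E (int k))"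
    by (simp add: c_def algebra_simps)
  also have "1 - u * poly E (int k) = v * p" using uv by simp
  finally have k: "p dvd poly (F + smult c E) (int k) - f (int k)" by simp
  have "p dvd poly (F + smult c E) (int i) - f (int i)" if "i < Suc k" for i
    using that k F(2)[of i] E0[of i] by (cases "i = k") auto
  moreover have "degree (F + smult c E) \<le> Suc k - 1"
    using F(1) dE by (intro degree_add_le) (auto intro: order.trans[OF degree_smult_le])
  ultimately show ?case by blast
qed

text \<open>If all these power sums vanished modulo \<open>p\<close>, so would the sum over
  \<open>S\<close> of every polynomial of degree at most \<open>card S\<close> without constant
  term. Some such polynomial is nonzero modulo \<open>p\<close> at exactly one element of
  \<open>S\<close>.\<close>

lemma power_sum_not_dvd:
  fixes p :: int and S :: "int set"
  assumes "prime p" "finite S" "S \<noteq> {}" "S \<subseteq> {1..<p}"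
  shows "\<exists>r\<ge>1. r \<le> card S \<and> \<not> p dvd (\<Sum>d\<in>S. d ^ r)"
proof (rule ccontr)
  assume contr: "\<not> ?thesis"
  obtain d0 where d0: "d0 \<in> S" using assms by auto
  \<comment> \<open>The factor \<open>X\<close> removes the constant term, which would bring in the
    power sum with exponent \<open>0\<close>; the others kill all of \<open>S\<close> except
    \<open>d0\<close>.\<close>
  define Q where "Q = [:0, 1:] * (\<Prod>d\<in>S - {d0}. [:- d, 1:])"
  have dQ: "degree Q \<le> card S"
  proof -
    have "degree (\<Prod>d\<in>S - {d0}. [:- d, 1:]) = card (S - {d0})"
      by (subst degree_prod_eq_sum_degree) auto
    then have "degree Q \<le> 1 + card (S - {d0})"
      unfolding Q_def using degree_mult_le[of "[:0,1:]" "\<Prod>d\<in>S - {d0}. [:- d, 1:]"] by simp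
    then show ?thesis using d0 assms(2)
      by (metis One_nat_def card.remove plus_1_eq_Suc)
  qed
  have "(\<Sum>d\<in>S. poly Q d) = (\<Sum>d\<in>S. if d = d0 then poly Q d0 else 0)"
  proof (rule sum.cong)
    fix d assume "d \<in> S"
    then show "poly Q d = (if d = d0 then poly Q d0 else 0)"
      using assms(2) by (auto simp: Q_def poly_prod)
  qed simp
  also have "\<dots> = poly Q d0" using d0 assms(2) by simp
  finally have s: "(\<Sum>d\<in>S. poly Q d) = poly Q d0" .
  have "(\<Sum>d\<in>S. poly Q d) = (\<Sum>i\<le>degree Q. coeff Q i * (\<Sum>d\<in>S. d ^ i))"
    unfolding poly_altdef by (subst sum.swap) (simp add: sum_distrib_left)
  also have "p dvd \<dots>"
  proof (rule dvd_sum)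
    fix i assume i: "i \<in> {..degree Q}"
    show "p dvd coeff Q i * (\<Sum>d\<in>S. d ^ i)"
    proof (cases "i = 0")
      case True
      then show ?thesis by (simp add: Q_def coeff_mult_0)
    next
      case False
      then show ?thesis using contr i dQ by (intro dvd_mult) (metis One_nat_def Suc_leI atMost_iff gr0I le_trans)
    qed
  qed
  finally have "p dvd poly Q d0" by (simp only: s)
  then have "p dvd d0 * (\<Prod>d\<in>S - {d0}. d0 - d)"
    by (simp add: Q_def poly_prod)
  then have "p dvd d0 \<or> (\<exists>d\<in>S - {d0}. p dvd d0 - d)"
    using assms(1,2) by (simp add: prime_dvd_mult_iff prime_dvd_prod_iff)
  then show False
  proof
    assume "p dvd d0"
    then show False using d0 assms(4) zdvd_imp_le[of p d0] by auto
  next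
    assume "\<exists>d\<in>S - {d0}. p dvd d0 - d"
    then obtain d where d: "d \<in> S" "d \<noteq> d0" "p dvd d0 - d" by auto
    then have "p dvd \<bar>d0 - d\<bar>" "0 < \<bar>d0 - d\<bar>" by auto
    then have "p \<le> \<bar>d0 - d\<bar>" using zdvd_imp_le by blast
    moreover have "1 \<le> d" "d < p" "1 \<le> d0" "d0 < p" using d d0 assms(4) by auto
    ultimately show False by linarith
  qed
qed

text \<open>Left side of the identity in Mueller's argument, with the dependence on \<open>S\<close>
  reduced to power sums by the binomial theorem.\<close>

lemma coeff_sum_pcompose_shift:
  fixes Q :: "int poly" and S :: "int set"
  shows "coeff (\<Sum>d\<in>S. pcompose Q [:d, 1:]) t
    = (\<Sum>c\<le>degree Q. coeff Q c * int (c choose t) * (\<Sum>d\<in>S. d ^ (c - t)))"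
proof -
  have X: "pcompose ([:0, 1:] ^ c) q = q ^ c" for q :: "int poly" and c
    by (induction c) (simp_all add: pcompose_mult pcompose_pCons pcompose_1)
  have L: "coeff ([:d, 1:] ^ c) t = int (c choose t) * d ^ (c - t)" for d :: int and c
  proof (cases "t \<le> c")
    case False
    then have "degree ([:d, 1:] ^ c) < t" by (simp add: degree_power_eq)
    then show ?thesis using False by (simp add: coeff_eq_0)
  qed (simp add: coeff_linear_poly_power)
  have "pcompose Q [:d, 1:] = (\<Sum>c\<le>degree Q. smult (coeff Q c) ([:d, 1:] ^ c))" for d :: int
    by (subst (1) poly_as_sum_of_monoms[of Q, symmetric], subst pcompose_sum)
       (simp add: monom_altdef pcompose_smult X)
  then have "coeff (pcompose Q [:d, 1:]) t
      = (\<Sum>c\<le>degree Q. coeff Q c * int (c choose t) * d ^ (c - t))" for d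
    by (simp add: coeff_sum L mult.assoc)
  then show ?thesis
    by (simp add: coeff_sum sum_distrib_left) (rule sum.swap)
qed

text \<open>The right side of the same identity, again reduced to power sums.\<close>

lemma coeff_sum_shift_power:
  fixes F :: "int poly" and S :: "int set"
  shows "coeff (\<Sum>d\<in>S. (F + [:d:]) ^ m) t
    = (\<Sum>j\<le>m. int (m choose j) * coeff (F ^ (m - j)) t * (\<Sum>d\<in>S. d ^ j))"
proof -
  have "coeff ((F + [:d:]) ^ m) t = (\<Sum>j\<le>m. int (m choose j) * coeff (F ^ (m - j)) t * d ^ j)" for d
    by (subst add.commute, subst binomial_ring)
       (simp add: coeff_sum poly_const_pow of_nat_poly ac_simps)
  then show ?thesis
    by (simp add: coeff_sum sum_distrib_left) (rule sum.swap)
qed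

text \<open>Mueller's proof of Burnside's theorem on permutation groups of prime degree: a permutation
  of the integers modulo \<open>p\<close> is a polynomial function \<open>F\<close>, and comparing a suitable coefficient in
  \<open>\<Sum>d\<in>S. F (x + d) ^ m = \<Sum>d\<in>S. (F x + d) ^ m\<close> shows that its degree is at most 1.\<close>

lemma affine_if_preserves_differences:
  fixes p :: int and f :: "int \<Rightarrow> int" and S :: "int set"
  assumes p: "prime p"
    and per: "\<And>i j. p dvd i - j \<Longrightarrow> p dvd f i - f j"
    and inj: "\<And>i j. p dvd f i - f j \<Longrightarrow> p dvd i - j"
    and S: "S \<noteq> {}" "S \<subseteq> {1..<p}" "2 * int (card S) < p"
    and pres: "\<And>i d. d \<in> S \<Longrightarrow> (f (i + d) - f i) mod p \<in> S"
  shows "\<exists>a b. \<forall>i. p dvd f i - (a * i + b)"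
proof -
  have p1: "p > 1" using p prime_gt_1_int by blast
  have fin: "finite S" using S(2) finite_subset by blast
  define w where "w j = (\<Sum>d\<in>S. d ^ j)" for j
  \<comment> \<open>The first power sum that survives modulo \<open>p\<close>. The bound on
    \<open>card S\<close> keeps \<open>r\<close> below half of \<open>p\<close>.\<close>
  define r where "r = (LEAST r. r \<ge> 1 \<and> \<not> p dvd w r)"
  obtain r' where r': "r' \<ge> 1" "r' \<le> card S" "\<not> p dvd w r'"
    using power_sum_not_dvd[OF p fin S(1,2)] by (auto simp: w_def)
  have r: "r \<ge> 1" "\<not> p dvd w r"
    using LeastI[of "\<lambda>r. r \<ge> 1 \<and> \<not> p dvd w r" r'] r' by (auto simp: r_def)
  have r_min: "p dvd w j" if "1 \<le> j" "j < r" for j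
    using not_less_Least[of j "\<lambda>r. r \<ge> 1 \<and> \<not> p dvd w r"] that by (auto simp: r_def)
  have "r \<le> r'" unfolding r_def by (rule Least_le) (use r' in auto)
  then have r_bound: "2 * int r < p" using r'(2) S(3) by simp

  define represents where "represents F \<longleftrightarrow> (\<forall>i. p dvd poly F i - f i)" for F
  \<comment> \<open>Least degree among the representing polynomials, so that the leading coefficient
    cannot vanish modulo \<open>p\<close>.\<close>
  define n where "n = (LEAST n. \<exists>F. degree F = n \<and> represents F)"
  obtain F0 where F0: "degree F0 \<le> nat p - 1" "\<And>i. i < nat p \<Longrightarrow> p dvd poly F0 (int i) - f (int i)"
    using interpolation_mod_prime[OF p, of "nat p" f] p1 by auto
  have "p dvd poly F0 i - f i" for i
  proof -
    have "p dvd poly F0 (i mod p) - f (i mod p)"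
      using F0(2)[of "nat (i mod p)"] p1 by simp
    moreover have "p dvd i - i mod p" by (simp add: dvd_minus_mod)
    then have "p dvd poly F0 i - poly F0 (i mod p)" "p dvd f i - f (i mod p)"
      using poly_cong_arg per by auto
    then have "p dvd (poly F0 i - poly F0 (i mod p)) + (poly F0 (i mod p) - f (i mod p))
        - (f i - f (i mod p))"
      using calculation by (meson dvd_diff dvd_add)
    then show ?thesis by simp
  qed
  then have F0': "represents F0" by (simp add: represents_def)
  obtain F where F: "degree F = n" "represents F"
    using LeastI[of "\<lambda>n. \<exists>F. degree F = n \<and> represents F" "degree F0"] F0' unfolding n_def by auto
  have n_min: "n \<le> degree F'" if "represents F'" for F'
    unfolding n_def by (rule Least_le) (use that in auto)
  have n_less: "int n < p" using n_min[OF F0'] F0(1) p1 by linarith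
  have Ff: "p dvd poly F i - f i" for i using F(2) by (simp add: represents_def)

  show ?thesis
  proof (cases "n \<le> 1")
    case True
    then obtain a b where "F = [:b, a:]" using F(1)
      by (metis One_nat_def degree_pCons_eq degree_0_id le_Suc_eq le_zero_eq pCons_cases
            Suc_inject pCons_0_0 degree_pCons_eq_if nat.simps(3))
    then have "p dvd f i - (a * i + b)" for i
      using Ff[of i] by (simp add: dvd_diff_commute algebra_simps)
    then show ?thesis by blast
  next
    case False
    have lead: "\<not> p dvd coeff F n"
    proof
      assume l: "p dvd coeff F n"
      let ?F = "F - monom (coeff F n) n"
      have "represents ?F" unfolding represents_def
      proof
        fix i
        have "poly ?F i - f i = (poly F i - f i) - coeff F n * i ^ n" by (simp add: poly_monom)
        then show "p dvd poly ?F i - f i" using Ff l by (metis dvd_diff dvd_mult2)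
      qed
      moreover have "degree ?F < n"
      proof (rule degree_lessI)
        show "?F \<noteq> 0 \<or> 0 < n" using False by simp
        show "\<forall>k\<ge>n. coeff ?F k = 0" using F(1) by (auto simp: coeff_eq_0)
      qed
      ultimately show False using n_min[of ?F] by simp
    qed
    \<comment> \<open>This is \<open>r / n\<close> rounded up, the least positive exponent with
      \<open>r <= n * m\<close>. It keeps \<open>n * m\<close> below \<open>p\<close>: the product
      is \<open>n\<close> itself, or at most \<open>r + n - 1 < 2 * r\<close>.\<close>
    define m where "m = (if r \<le> n then 1 else (r + n - 1) div n)"
    have m: "m \<le> r" "r \<le> n * m" "int (n * m) < p" "1 \<le> m"
    proof -
      show "1 \<le> m" using False r(1) by (auto simp: m_def Suc_le_eq div_greater_zero_iff)
      show "r \<le> n * m"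
      proof (cases "r \<le> n")
        case False
        have "(r + n - 1) mod n < n" using \<open>\<not> n \<le> 1\<close> by simp
        moreover have "n * ((r + n - 1) div n) + (r + n - 1) mod n = r + n - 1" by simp
        ultimately have "r \<le> n * ((r + n - 1) div n)" by linarith
        then show ?thesis using False by (simp only: m_def if_False)
      qed (simp add: m_def)
      show "int (n * m) < p"
      proof (cases "r \<le> n")
        case True
        then show ?thesis using n_less by (simp add: m_def)
      next
        case nr: False
        have "n * m \<le> r + n - 1" using nr by (simp add: m_def)
        then have "n * m < 2 * r" using nr by linarith
        then show ?thesis using r_bound by linarith
      qed
      show "m \<le> r"
      proof (cases "r \<le> n")
        case nr: False
        have "n * m \<le> r + n - 1" using nr by (simp add: m_def)
        moreover have "r + n - 1 < n * (r + 1)"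
        proof -
          have "r \<le> n * r" using False by (cases n) auto
          then have "r + n - 1 < n + n * r" using False by linarith
          then show ?thesis by simp
        qed
        ultimately have "n * m < n * (r + 1)" by linarith
        then have "m < r + 1" using nat_mult_less_cancel_disj by blast
        then show ?thesis by simp
      qed (use r(1) in \<open>simp add: m_def\<close>)
    qed
    define N where "N = n * m"
    have dN: "degree (F ^ m) = N" using F(1) lead by (subst degree_power_eq) (auto simp: N_def)
    define R where "R = (\<Sum>d\<in>S. pcompose (F ^ m) [:d, 1:]) - (\<Sum>d\<in>S. (F + [:d:]) ^ m)"
    have R0: "p dvd poly R i" for i
    proof -
      \<comment> \<open>\<open>s\<close> permutes \<open>S\<close>, so the second sum may be taken
        over \<open>s d\<close> instead of \<open>d\<close>; then the two sums agree modulo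
        \<open>p\<close> term by term.\<close>
      define s where "s d = (f (i + d) - f i) mod p" for d
      have "inj_on s S"
      proof (rule inj_onI)
        fix d e assume de: "d \<in> S" "e \<in> S" "s d = s e"
        then have "p dvd (f (i + d) - f i) - (f (i + e) - f i)"
          by (simp add: s_def mod_eq_dvd_iff)
        then have "p dvd (i + d) - (i + e)" using inj[of "i + d" "i + e"] by simp
        then have "d mod p = e mod p" by (simp add: mod_eq_dvd_iff)
        moreover have "0 \<le> d" "d < p" "0 \<le> e" "e < p" using de S(2) by force+
        ultimately show "d = e" by (simp add: mod_pos_pos_trivial)
      qed
      moreover have "s ` S \<subseteq> S" using pres by (auto simp: s_def)
      ultimately have s: "bij_betw s S S"
        using fin by (simp add: bij_betw_def endo_inj_surj)
      have cong: "p dvd poly F (i + d) ^ m - (poly F i + s d) ^ m" for d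
      proof -
        have "p dvd (f (i + d) - f i) - s d" by (simp add: s_def dvd_minus_mod)
        then have "p dvd (poly F (i + d) - f (i + d)) - (poly F i - f i) + ((f (i + d) - f i) - s d)"
          using Ff by (meson dvd_add dvd_diff)
        then have "p dvd poly F (i + d) - (poly F i + s d)" by (simp add: algebra_simps)
        then show ?thesis using poly_cong_arg[of p _ _ "monom 1 m"] by (simp add: poly_monom)
      qed
      have "(\<Sum>d\<in>S. (poly F i + d) ^ m) = (\<Sum>d\<in>S. (poly F i + s d) ^ m)"
        using sum.reindex_bij_betw[OF s, of "\<lambda>d. (poly F i + d) ^ m"] by simp
      then have "poly R i = (\<Sum>d\<in>S. poly F (i + d) ^ m - (poly F i + s d) ^ m)"
        by (simp add: R_def poly_sum poly_pcompose sum_subtractf add.commute)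
      then show ?thesis using cong by (simp add: dvd_sum)
    qed
    have dR: "degree R \<le> N"
    proof -
      have "degree (pcompose (F ^ m) [:d, 1:]) \<le> N" for d
        using dN by (simp add: degree_pcompose)
      moreover have "degree ((F + [:d:]) ^ m) \<le> N" for d
      proof -
        have "degree (F + [:d:]) \<le> n" using F(1) by (intro degree_add_le) auto
        then show ?thesis using degree_power_le[of "F + [:d:]" m] by (simp add: N_def)
          (meson le_trans mult_le_mono1)
      qed
      ultimately show ?thesis unfolding R_def using fin
        by (intro degree_diff_le degree_sum_le) auto
    qed
    \<comment> \<open>In this degree the left sum has the terms \<open>w (c - t)\<close> with
      \<open>c - t <= r\<close>. Only \<open>c = t\<close>, which cancels against the right sum, and
      \<open>c = N\<close>, which carries \<open>w r\<close>, survive modulo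
      \<open>p\<close>.\<close>
    define t where "t = N - r"
    have Rt: "p dvd coeff R t"
      using dvd_coeffs_if_dvd_values[OF p dR, of t] m(3) R0 by (simp add: N_def)
    have Rl: "p dvd coeff (\<Sum>d\<in>S. pcompose (F ^ m) [:d, 1:]) t
        - (coeff (F ^ m) t * w 0 + coeff (F ^ m) N * int (N choose t) * w r)"
    proof -
      define g where "g c = coeff (F ^ m) c * int (c choose t) * w (c - t)" for c
      have t: "t < N" "N - t = r" using m(2) r(1) by (auto simp: t_def N_def)
      have "coeff (\<Sum>d\<in>S. pcompose (F ^ m) [:d, 1:]) t = (\<Sum>c\<le>N. g c)"
        by (simp add: coeff_sum_pcompose_shift dN g_def w_def)
      also have "\<dots> = g t + (g N + (\<Sum>c\<in>{..N} - {t} - {N}. g c))"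
        using t by (subst sum.remove[of _ t], simp, simp, subst sum.remove[of _ N]) auto
      also have "\<dots> - (coeff (F ^ m) t * w 0 + coeff (F ^ m) N * int (N choose t) * w r)
          = (\<Sum>c\<in>{..N} - {t} - {N}. g c)"
        using t by (simp add: g_def)
      also have "p dvd \<dots>"
      proof (rule dvd_sum)
        fix c assume c: "c \<in> {..N} - {t} - {N}"
        show "p dvd g c"
        proof (cases "c < t")
          case False
          then have "p dvd w (c - t)" using c t by (intro r_min) auto
          then show ?thesis by (simp add: g_def)
        qed (simp add: g_def binomial_eq_0)
      qed
      finally show ?thesis .
    qed
    have Rr: "p dvd coeff (\<Sum>d\<in>S. (F + [:d:]) ^ m) t - coeff (F ^ m) t * w 0"
    proof -
      define g where "g j = int (m choose j) * coeff (F ^ (m - j)) t * w j" for j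
      have "coeff (\<Sum>d\<in>S. (F + [:d:]) ^ m) t = (\<Sum>j\<le>m. g j)"
        by (simp add: coeff_sum_shift_power g_def w_def)
      also have "\<dots> = g 0 + (\<Sum>j\<in>{..m} - {0}. g j)"
        by (subst sum.remove[of _ 0]) auto
      also have "\<dots> - coeff (F ^ m) t * w 0 = (\<Sum>j\<in>{..m} - {0}. g j)"
        by (simp add: g_def)
      also have "p dvd \<dots>"
      proof (rule dvd_sum)
        fix j assume j: "j \<in> {..m} - {0}"
        show "p dvd g j"
        proof (cases "j < r")
          case True
          then show ?thesis using r_min[of j] j by (simp add: g_def)
        next
          case jr: False
          \<comment> \<open>The only index that escapes the minimality of \<open>r\<close>. Here
            \<open>F ^ (m - j)\<close> is the constant \<open>1\<close>, without a term of degree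
            \<open>t > 0\<close>.\<close>
          then have "j = m" "m = r" using j m(1) by auto
          moreover have "t > 0" using False r(1) \<open>m = r\<close> by (simp add: t_def N_def)
          ultimately show ?thesis by (simp add: g_def coeff_1)
        qed
      qed
      finally show ?thesis .
    qed
    have "p dvd v" if "p dvd s - s'" "p dvd s - (u + v)" "p dvd s' - u" for s s' u v :: int
    proof -
      have "p dvd (s - s') - (s - (u + v)) + (s' - u)" by (intro dvd_add dvd_diff that)
      then show ?thesis by simp
    qed
    note comb = this
    have "p dvd coeff (F ^ m) N * int (N choose t) * w r"
      by (rule comb[OF Rt[unfolded R_def coeff_diff] Rl Rr])
    moreover have "coeff (F ^ m) N = coeff F n ^ m"
      using F(1) dN lead_coeff_power[of F m] by simp
    moreover have "\<not> p dvd int (N choose t)"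
    proof
      assume "p dvd int (N choose t)"
      moreover have "(N choose t) dvd fact N"
        using binomial_fact_lemma[of t N] by (metis dvd_triv_right diff_le_self t_def)
      ultimately have "p dvd int (fact N)" by (meson dvd_trans int_dvd_int_iff)
      then have "p dvd (\<Prod>i=1..N. int i)" by (simp add: fact_prod)
      then obtain i where "i \<in> {1..N}" "p dvd int i"
        unfolding prime_dvd_prod_iff[OF finite_atLeastAtMost p] by blast
      then have "p \<le> int N" using zdvd_imp_le[of p "int i"] by auto
      then show False using m(3) by (simp add: N_def)
    qed
    ultimately show ?thesis
      using lead r(2) p by (auto simp: prime_dvd_mult_iff dest: prime_dvd_power)
  qed
qed

section \<open>Orbits and conjugacy classes\<close>

context group
begin

text \<open>Orbit-stabilizer counting: the fibres of the map are left cosets of the fibre over its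
  value at the identity. Being stated for a map, it applies to conjugating a pair of elements as
  well as a single one.\<close>

lemma card_image_times_fibre:
  assumes K: "subgroup K G" and fin: "finite K"
    and \<phi>: "\<And>g s. g \<in> K \<Longrightarrow> s \<in> K \<Longrightarrow> \<phi> (g \<otimes> s) = \<phi> g \<longleftrightarrow> \<phi> s = \<phi> \<one>"
  shows "card (\<phi> ` K) * card {s \<in> K. \<phi> s = \<phi> \<one>} = card K"
proof -
  have sub: "K \<subseteq> carrier G" using K subgroup.subset by blast
  have fibre: "card {k \<in> K. \<phi> k = b} = card {s \<in> K. \<phi> s = \<phi> \<one>}" if b: "b \<in> \<phi> ` K" for b
  proof -
    obtain g where g: "g \<in> K" "b = \<phi> g" using b by blast
    have "(\<otimes>) g ` {s \<in> K. \<phi> s = \<phi> \<one>} = {k \<in> K. \<phi> k = b}"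
    proof (intro equalityI subsetI)
      fix k assume k: "k \<in> {k \<in> K. \<phi> k = b}"
      have "inv g \<otimes> k \<in> K" using K g k by (simp add: subgroup.m_closed subgroup.m_inv_closed)
      moreover have gk: "k = g \<otimes> (inv g \<otimes> k)"
        using g k sub by (simp add: inv_solve_left' subset_iff flip: m_assoc)
      ultimately have "\<phi> (inv g \<otimes> k) = \<phi> \<one>" using \<phi>[of g "inv g \<otimes> k"] g k by auto
      then show "k \<in> (\<otimes>) g ` {s \<in> K. \<phi> s = \<phi> \<one>}"
        using gk \<open>inv g \<otimes> k \<in> K\<close> by blast
    qed (use g \<phi> K in \<open>auto simp: subgroup.m_closed\<close>)
    moreover have inj: "inj_on ((\<otimes>) g) {s \<in> K. \<phi> s = \<phi> \<one>}"
    proof (rule inj_onI)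
      fix s t assume "s \<in> {s \<in> K. \<phi> s = \<phi> \<one>}" "t \<in> {s \<in> K. \<phi> s = \<phi> \<one>}" "g \<otimes> s = g \<otimes> t"
      moreover from this(1,2) have "s \<in> carrier G" "t \<in> carrier G" using sub by blast+
      ultimately show "s = t" using l_cancel[of g s t] subsetD[OF sub g(1)] by simp
    qed
    ultimately show ?thesis using card_image[OF inj] by simp
  qed
  have "card K = (\<Sum>b\<in>\<phi> ` K. card {k \<in> K. \<phi> k = b})"
    using sum.image_gen[OF fin, of "\<lambda>_. 1::nat" \<phi>] by simp
  then show ?thesis using fibre by simp
qed

text \<open>\<open>a\<close> has to be an action only on \<open>K\<close> and \<open>Y\<close>. It
  is instantiated with conjugation and with left multiplication.\<close>

lemma dvd_card_if_dvd_orbits: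
  assumes K: "subgroup K G" and fin: "finite Y"
    and closed: "\<And>g x. g \<in> K \<Longrightarrow> x \<in> Y \<Longrightarrow> a g x \<in> Y"
    and one: "\<And>x. x \<in> Y \<Longrightarrow> a \<one> x = x"
    and mult: "\<And>g h x. g \<in> K \<Longrightarrow> h \<in> K \<Longrightarrow> x \<in> Y \<Longrightarrow> a (g \<otimes> h) x = a g (a h x)"
    and dvd: "\<And>x. x \<in> Y \<Longrightarrow> k dvd card ((\<lambda>g. a g x) ` K)"
  shows "k dvd card Y"
proof -
  define O' where "O' x = (\<lambda>g. a g x) ` K" for x
  have one_K: "\<one> \<in> K" using K by (simp add: subgroup.one_closed)
  have sub: "K \<subseteq> carrier G" using K subgroup.subset by blast
  have eq: "O' (a g x) = O' x" if gx: "g \<in> K" "x \<in> Y" for g x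
  proof (intro equalityI subsetI)
    fix z assume "z \<in> O' (a g x)"
    then obtain h where h: "h \<in> K" "z = a h (a g x)" by (auto simp: O'_def)
    then have "z = a (h \<otimes> g) x" "h \<otimes> g \<in> K" using gx K mult by (auto simp: subgroup.m_closed)
    then show "z \<in> O' x" by (simp add: O'_def)
  next
    fix z assume "z \<in> O' x"
    then obtain h where h: "h \<in> K" "z = a h x" by (auto simp: O'_def)
    have "h = (h \<otimes> inv g) \<otimes> g"
      using h gx sub by (simp add: m_assoc subset_iff)
    moreover have "h \<otimes> inv g \<in> K" using K h gx by (simp add: subgroup.m_closed subgroup.m_inv_closed)
    ultimately have "z = a (h \<otimes> inv g) (a g x)" using mult gx h by metis
    then show "z \<in> O' (a g x)" using \<open>h \<otimes> inv g \<in> K\<close> by (auto simp: O'_def)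
  qed
  have "\<Union>(O' ` Y) = Y" using one_K one closed by (force simp: O'_def)
  moreover have "k dvd card (\<Union>(O' ` Y))"
  proof (rule dvd_partition)
    show "finite (\<Union>(O' ` Y))" using \<open>\<Union>(O' ` Y) = Y\<close> fin by simp
    show "\<forall>c\<in>O' ` Y. k dvd card c" using dvd by (auto simp: O'_def)
    show "\<forall>c1\<in>O' ` Y. \<forall>c2\<in>O' ` Y. c1 \<noteq> c2 \<longrightarrow> c1 \<inter> c2 = {}"
    proof (intro ballI impI, rule ccontr)
      fix c1 c2 assume c: "c1 \<in> O' ` Y" "c2 \<in> O' ` Y" "c1 \<noteq> c2" "c1 \<inter> c2 \<noteq> {}"
      then obtain x1 x2 g1 g2 where "x1 \<in> Y" "x2 \<in> Y" "c1 = O' x1" "c2 = O' x2"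
        "g1 \<in> K" "g2 \<in> K" "a g1 x1 = a g2 x2" by (force simp: O'_def)
      then show False using eq c(3) by metis
    qed
  qed
  ultimately show ?thesis by simp
qed

text \<open>Agrees with \<open>conj_by\<close> on the carrier but is not cut off outside it, so that
  it unfolds without case distinctions.\<close>

definition cj :: "'a \<Rightarrow> 'a \<Rightarrow> 'a" where "cj g x = g \<otimes> x \<otimes> inv g"

definition cls :: "'a \<Rightarrow> 'a set" where "cls x = (\<lambda>g. cj g x) ` carrier G"

definition cent :: "'a \<Rightarrow> 'a set" where "cent x = {g \<in> carrier G. g \<otimes> x = x \<otimes> g}"

lemma cj_closed [simp, intro]: "g \<in> carrier G \<Longrightarrow> x \<in> carrier G \<Longrightarrow> cj g x \<in> carrier G"
  by (simp add: cj_def)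

lemma cj_one [simp]: "x \<in> carrier G \<Longrightarrow> cj \<one> x = x"
  by (simp add: cj_def)

lemma cj_one_right [simp]: "g \<in> carrier G \<Longrightarrow> cj g \<one> = \<one>"
  by (simp add: cj_def)

lemma cj_mult: "g \<in> carrier G \<Longrightarrow> h \<in> carrier G \<Longrightarrow> x \<in> carrier G \<Longrightarrow> cj (g \<otimes> h) x = cj g (cj h x)"
  by (simp add: cj_def inv_mult_group m_assoc)

lemma inv_mult_cancel: "g \<in> carrier G \<Longrightarrow> x \<in> carrier G \<Longrightarrow> inv g \<otimes> (g \<otimes> x) = x"
  by (simp flip: m_assoc)

lemma cj_prod: "g \<in> carrier G \<Longrightarrow> x \<in> carrier G \<Longrightarrow> y \<in> carrier G \<Longrightarrow> cj g (x \<otimes> y) = cj g x \<otimes> cj g y"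
  by (simp add: cj_def m_assoc inv_mult_cancel)

lemma cj_inv_left [simp]: "g \<in> carrier G \<Longrightarrow> x \<in> carrier G \<Longrightarrow> cj (inv g) (cj g x) = x"
  by (simp flip: cj_mult)

lemma cj_inv_right [simp]: "g \<in> carrier G \<Longrightarrow> x \<in> carrier G \<Longrightarrow> cj g (cj (inv g) x) = x"
  by (simp flip: cj_mult)

lemma cj_inject: "g \<in> carrier G \<Longrightarrow> x \<in> carrier G \<Longrightarrow> y \<in> carrier G \<Longrightarrow> cj g x = cj g y \<longleftrightarrow> x = y"
  by (metis cj_inv_left)

lemma cj_fixed_iff: "g \<in> carrier G \<Longrightarrow> x \<in> carrier G \<Longrightarrow> cj g x = x \<longleftrightarrow> g \<otimes> x = x \<otimes> g"
  by (metis cj_def inv_closed inv_solve_right m_closed)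

lemma mem_cent_iff: "x \<in> carrier G \<Longrightarrow> g \<in> cent x \<longleftrightarrow> g \<in> carrier G \<and> cj g x = x"
  by (auto simp: cent_def cj_fixed_iff)

lemma cent_commute: "x \<in> carrier G \<Longrightarrow> y \<in> carrier G \<Longrightarrow> x \<in> cent y \<longleftrightarrow> y \<in> cent x"
  by (auto simp: cent_def)

lemma cent_subset: "cent x \<subseteq> carrier G"
  by (auto simp: cent_def)

lemma self_mem_cent: "x \<in> carrier G \<Longrightarrow> x \<in> cent x"
  by (auto simp: cent_def)

lemma subgroup_cent: "x \<in> carrier G \<Longrightarrow> subgroup (cent x) G"
proof (rule subgroupI)
  assume x: "x \<in> carrier G"
  show "cent x \<noteq> {}" using self_mem_cent[OF x] by auto
  show "\<And>g. g \<in> cent x \<Longrightarrow> inv g \<in> cent x"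
    using x by (auto simp: mem_cent_iff) (metis cj_inv_left)
  show "\<And>g h. g \<in> cent x \<Longrightarrow> h \<in> cent x \<Longrightarrow> g \<otimes> h \<in> cent x"
    using x by (auto simp: mem_cent_iff cj_mult)
qed (auto simp: cent_def)

lemma mem_cent_cj_iff:
  assumes "g \<in> carrier G" "x \<in> carrier G" "k \<in> carrier G"
  shows "cj g k \<in> cent (cj g x) \<longleftrightarrow> k \<in> cent x"
  using assms by (simp add: cent_def cj_inject flip: cj_prod)

lemma cent_cj:
  assumes "g \<in> carrier G" "x \<in> carrier G"
  shows "cent (cj g x) = cj g ` cent x"
proof (intro equalityI subsetI)
  fix k assume k: "k \<in> cent (cj g x)"
  then have c: "k \<in> carrier G" using cent_subset by blast
  then have "cj (inv g) k \<in> cent x"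
    using mem_cent_cj_iff[of g x "cj (inv g) k"] assms k by simp
  then show "k \<in> cj g ` cent x" using assms c by (intro image_eqI[of _ _ "cj (inv g) k"]) auto
next
  fix k assume "k \<in> cj g ` cent x"
  then show "k \<in> cent (cj g x)" using mem_cent_cj_iff assms cent_subset by blast
qed

lemma cent_eq_cj:
  assumes "g \<in> carrier G" "x \<in> carrier G" "y \<in> carrier G" "cent x = cent y"
  shows "cent (cj g x) = cent (cj g y)"
  using assms by (simp add: cent_cj)

lemma cls_subset: "x \<in> carrier G \<Longrightarrow> cls x \<subseteq> carrier G"
  by (auto simp: cls_def)

lemma self_mem_cls: "x \<in> carrier G \<Longrightarrow> x \<in> cls x"
  unfolding cls_def by (rule image_eqI[of _ _ \<one>]) auto

lemma cj_mem_cls: "x \<in> carrier G \<Longrightarrow> g \<in> carrier G \<Longrightarrow> b \<in> cls x \<Longrightarrow> cj g b \<in> cls x"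
  unfolding cls_def by (auto simp flip: cj_mult)

lemma cls_cj: "x \<in> carrier G \<Longrightarrow> g \<in> carrier G \<Longrightarrow> cls (cj g x) = cls x"
proof (intro equalityI subsetI)
  fix z assume A: "x \<in> carrier G" "g \<in> carrier G" "z \<in> cls x"
  then obtain h where h: "h \<in> carrier G" "z = cj h x" by (auto simp: cls_def)
  then have "z = cj (h \<otimes> inv g) (cj g x)" using A by (simp add: cj_mult)
  then show "z \<in> cls (cj g x)" using A h by (auto simp: cls_def)
qed (auto simp: cls_def simp flip: cj_mult)

lemma cls_eq: "x \<in> carrier G \<Longrightarrow> b \<in> cls x \<Longrightarrow> cls b = cls x"
proof -
  assume x: "x \<in> carrier G" and "b \<in> cls x"
  then obtain g where "g \<in> carrier G" "b = cj g x" by (auto simp: cls_def)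
  then show ?thesis using cls_cj[OF x] by simp
qed

lemma card_orbit_cj:
  assumes "subgroup K G" "finite K" "x \<in> carrier G"
  shows "card ((\<lambda>g. cj g x) ` K) * card (K \<inter> cent x) = card K"
proof -
  have sub: "K \<subseteq> carrier G" using assms(1) subgroup.subset by blast
  have "{s \<in> K. cj s x = cj \<one> x} = K \<inter> cent x" using sub assms(3) by (auto simp: mem_cent_iff)
  moreover have "card ((\<lambda>g. cj g x) ` K) * card {s \<in> K. cj s x = cj \<one> x} = card K"
    using sub assms(3)
    by (intro card_image_times_fibre[OF assms(1,2)]) (auto simp: cj_mult cj_inject subset_iff)
  ultimately show ?thesis by simp
qed

lemma dvd_card_cj_invariant:
  assumes K: "subgroup K G" and fin: "finite Y" and sub: "Y \<subseteq> carrier G"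
    and closed: "\<And>g x. g \<in> K \<Longrightarrow> x \<in> Y \<Longrightarrow> cj g x \<in> Y"
    and dvd: "\<And>x. x \<in> Y \<Longrightarrow> k dvd card ((\<lambda>g. cj g x) ` K)"
  shows "k dvd card Y"
proof -
  have K': "K \<subseteq> carrier G" using K subgroup.subset by blast
  have mult: "cj (g \<otimes> h) x = cj g (cj h x)" if "g \<in> K" "h \<in> K" "x \<in> Y" for g h x
    using that K' sub by (simp add: cj_mult subset_iff)
  have one: "cj \<one> x = x" if "x \<in> Y" for x using that sub by (simp add: subset_iff)
  show ?thesis
    by (rule dvd_card_if_dvd_orbits[where a = cj, OF K fin closed one mult dvd])
qed

text \<open>Orbits of a group of prime order have length \<open>1\<close> or \<open>p\<close>, and
  the elements not centralized by \<open>P\<close> make up the orbits of length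
  \<open>p\<close>.\<close>

lemma dvd_card_nonfixed:
  assumes P: "subgroup P G" "card P = p" "prime p" and Y: "finite Y" "Y \<subseteq> carrier G"
    and closed: "\<And>g x. g \<in> P \<Longrightarrow> x \<in> Y \<Longrightarrow> cj g x \<in> Y"
  shows "p dvd card {x \<in> Y. \<not> P \<subseteq> cent x}"
proof (rule dvd_card_cj_invariant[OF P(1)])
  have sub: "P \<subseteq> carrier G" using P subgroup.subset by blast
  have fin: "finite P" using P(2,3) card_ge_0_finite prime_gt_0_nat by blast
  show "cj g x \<in> {x \<in> Y. \<not> P \<subseteq> cent x}" if g: "g \<in> P" and x: "x \<in> {x \<in> Y. \<not> P \<subseteq> cent x}" for g x
  proof -
    have "\<not> P \<subseteq> cent (cj g x)"
    proof
      assume A: "P \<subseteq> cent (cj g x)"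
      have "h \<in> cent x" if h: "h \<in> P" for h
      proof -
        have "cj g h \<in> P" using P(1) g h by (simp add: cj_def subgroup.m_closed subgroup.m_inv_closed)
        then show ?thesis using A mem_cent_cj_iff[of g x h] g h sub x Y(2) by blast
      qed
      then show False using x by blast
    qed
    then show ?thesis using closed g x by auto
  qed
  show "p dvd card ((\<lambda>g. cj g x) ` P)" if x: "x \<in> {x \<in> Y. \<not> P \<subseteq> cent x}" for x
  proof -
    have xc: "x \<in> carrier G" using x Y by auto
    have e: "card ((\<lambda>g. cj g x) ` P) * card (P \<inter> cent x) = p"
      using card_orbit_cj[OF P(1) fin xc] P(2) by simp
    have "P \<inter> cent x \<noteq> P" using x by blast
    then have "card (P \<inter> cent x) < p" using P(2) fin
      by (metis inf_le1 psubsetI psubset_card_mono)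
    then show ?thesis using e P(3)
      by (metis dvd_triv_left dvd_triv_right less_not_refl mult.right_neutral prime_nat_iff dvd_refl)
  qed
qed (use Y in auto)

end

section \<open>Prime groups and coprime class sizes\<close>

context group
begin

lemma card_subgroup_dvd:
  assumes "subgroup I G" "subgroup K G" "I \<subseteq> K"
  shows "card I dvd card K"
proof -
  interpret K: group "G\<lparr>carrier := K\<rparr>" using assms(2) by (rule subgroup.subgroup_is_group) (rule is_group)
  have "subgroup I (G\<lparr>carrier := K\<rparr>)" using assms by (simp add: subgroup_incl)
  from K.lagrange[OF this] show ?thesis by (auto simp: Coset.order_def) (metis dvd_triv_right)
qed

text \<open>Left multiplication by an element of the finite set is injective on it, hence onto,
  hence reaches the identity.\<close>

lemma subgroup_if_mult_closed:
  assumes "finite Y" "Y \<subseteq> carrier G" "\<one> \<in> Y" "\<And>a b. a \<in> Y \<Longrightarrow> b \<in> Y \<Longrightarrow> a \<otimes> b \<in> Y"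
  shows "subgroup Y G"
proof (rule subgroupI)
  fix a assume a: "a \<in> Y"
  have "inj_on ((\<otimes>) a) Y" using a assms(2)
    by (intro inj_onI) (metis l_cancel subsetD)
  then have "(\<otimes>) a ` Y = Y" using assms a by (intro endo_inj_surj) auto
  then obtain b where b: "b \<in> Y" "a \<otimes> b = \<one>" using assms(3) by (metis imageE)
  then have "inv a = b" using a assms(2) by (meson inv_equality inv_comm subsetD)
  then show "inv a \<in> Y" using b by simp
qed (use assms in auto)

definition commutant :: "'a set \<Rightarrow> 'a set"
  where "commutant Y = {g \<in> carrier G. \<forall>u\<in>Y. g \<in> cent u}"

lemma normal_iff: "N \<lhd> G \<longleftrightarrow> subgroup N G \<and> (\<forall>g\<in>carrier G. \<forall>u\<in>N. cj g u \<in> N)"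
  by (simp add: normal_inv_iff cj_def)

lemma normal_commutant:
  assumes "Y \<subseteq> carrier G" "\<And>g u. g \<in> carrier G \<Longrightarrow> u \<in> Y \<Longrightarrow> cj g u \<in> Y"
  shows "commutant Y \<lhd> G"
  unfolding normal_iff
proof (intro conjI ballI)
  show "subgroup (commutant Y) G"
  proof (rule subgroupI)
    show "commutant Y \<noteq> {}"
      using assms(1) by (auto simp: commutant_def cent_def intro!: exI[of _ \<one>])
  qed (use assms(1) in \<open>auto simp: commutant_def subset_iff intro: subgroup.m_closed[OF subgroup_cent]
        subgroup.m_inv_closed[OF subgroup_cent]\<close>)
  fix g k assume g: "g \<in> carrier G" and k: "k \<in> commutant Y"
  have kc: "k \<in> carrier G" using k by (simp add: commutant_def)
  have "cj g k \<in> cent u" if u: "u \<in> Y" for u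
  proof -
    have "k \<in> cent (cj (inv g) u)" using k assms(2) g u by (auto simp: commutant_def)
    then have "cj g k \<in> cent (cj g (cj (inv g) u))"
      using g kc u assms(1) by (subst mem_cent_cj_iff) auto
    then show ?thesis using g u assms(1) by (simp add: subset_iff)
  qed
  then show "cj g k \<in> commutant Y" using g kc by (auto simp: commutant_def)
qed

end

text \<open>Like prime rings, with ideals replaced by normal subgroups and products by commutators.\<close>

locale finite_prime_group = group +
  assumes finite_carrier [simp]: "finite (carrier G)"
    and prime_normal: "\<And>N M. N \<lhd> G \<Longrightarrow> M \<lhd> G \<Longrightarrow> (\<And>a b. a \<in> N \<Longrightarrow> b \<in> M \<Longrightarrow> a \<otimes> b = b \<otimes> a)
      \<Longrightarrow> N = {\<one>} \<or> M = {\<one>}"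
begin

lemma finite_subset_carrier: "Y \<subseteq> carrier G \<Longrightarrow> finite Y"
  using finite_carrier finite_subset by blast

lemma finite_subgroup: "subgroup K G \<Longrightarrow> finite K"
  using finite_subset_carrier subgroup.subset by blast

lemma finite_cls [simp]: "x \<in> carrier G \<Longrightarrow> finite (cls x)"
  by (simp add: cls_def)

lemma finite_cent [simp]: "finite (cent x)"
  using finite_subset_carrier cent_subset by blast

lemma card_subgroup_pos: "subgroup K G \<Longrightarrow> card K > 0"
  using finite_subgroup subgroup.one_closed card_gt_0_iff by blast

lemma card_cls_cent: "x \<in> carrier G \<Longrightarrow> card (cls x) * card (cent x) = card (carrier G)"
  using card_orbit_cj[OF subgroup_self, of x] cent_subset[of x]
  by (simp add: cls_def Int_absorb1)

text \<open>The centralizer of an invariant set and the centralizer of that centralizer are normal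
  and commute elementwise; the second contains \<open>y\<close>.\<close>

lemma commutant_trivial:
  assumes "Y \<subseteq> carrier G" "\<And>g u. g \<in> carrier G \<Longrightarrow> u \<in> Y \<Longrightarrow> cj g u \<in> Y" "y \<in> Y" "y \<noteq> \<one>"
  shows "commutant Y = {\<one>}"
proof -
  have N: "commutant Y \<lhd> G" using normal_commutant assms by blast
  then have M: "commutant (commutant Y) \<lhd> G"
    by (intro normal_commutant) (auto simp: normal_iff commutant_def)
  have "y \<in> commutant (commutant Y)"
    using assms(1,3) by (auto simp: commutant_def cent_commute subset_iff)
  moreover have "commutant Y = {\<one>} \<or> commutant (commutant Y) = {\<one>}"
    by (rule prime_normal[OF N M]) (auto simp: commutant_def cent_def)
  ultimately show ?thesis using assms(4) by blast
qed

lemma faithful_on_cls: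
  assumes "x \<in> carrier G" "x \<noteq> \<one>" "g \<in> carrier G" "\<And>b. b \<in> cls x \<Longrightarrow> g \<in> cent b"
  shows "g = \<one>"
proof -
  have "g \<in> commutant (cls x)" using assms by (simp add: commutant_def)
  moreover have "commutant (cls x) = {\<one>}"
    using assms cls_subset self_mem_cls cj_mem_cls by (intro commutant_trivial[of _ x]) auto
  ultimately show ?thesis by simp
qed

lemma card_cls_gt_1:
  assumes "x \<in> carrier G" "x \<noteq> \<one>"
  shows "card (cls x) > 1"
proof (rule ccontr)
  assume "\<not> card (cls x) > 1"
  moreover have "x \<in> cls x" "finite (cls x)" using assms self_mem_cls by auto
  ultimately have "cls x = {x}"
    by (metis card_le_Suc0_iff_eq One_nat_def linorder_not_le singletonI subsetI subset_singletonD equals0D insert_iff set_eq_iff)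
  then show False using faithful_on_cls[OF assms assms(1)] self_mem_cent assms by auto
qed

text \<open>A normal \<open>M\<close> cuts the class of \<open>x\<close> into orbits of one common
  length, which divides both cardinalities. If these were coprime, \<open>M\<close> would centralize
  the class, against faithfulness.\<close>

lemma normal_not_coprime:
  assumes M: "M \<lhd> G" "M \<noteq> {\<one>}" and x: "x \<in> carrier G" "x \<noteq> \<one>"
  shows "\<not> coprime (card M) (card (cls x))"
proof
  assume co: "coprime (card M) (card (cls x))"
  have sM: "subgroup M G" and nM: "\<And>g u. g \<in> carrier G \<Longrightarrow> u \<in> M \<Longrightarrow> cj g u \<in> M"
    using M(1) by (auto simp: normal_iff)
  have subM: "M \<subseteq> carrier G" using sM subgroup.subset by blast
  have fM: "finite M" using sM finite_subgroup by blast
  define s where "s = card ((\<lambda>g. cj g x) ` M)"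
  have int_eq: "card (M \<inter> cent b) = card (M \<inter> cent x)" if b: "b \<in> cls x" for b
  proof -
    obtain g where g: "g \<in> carrier G" "b = cj g x" using b by (auto simp: cls_def)
    have "M \<inter> cent b = cj g ` (M \<inter> cent x)"
    proof (intro equalityI subsetI)
      fix k assume k: "k \<in> M \<inter> cent b"
      then have "k = cj g (cj (inv g) k)" "cj (inv g) k \<in> M" using g subM nM by auto
      moreover then have "cj (inv g) k \<in> cent x"
        using k g x subM mem_cent_cj_iff[of g x "cj (inv g) k"] by auto
      ultimately show "k \<in> cj g ` (M \<inter> cent x)" by blast
    qed (use g x nM subM mem_cent_cj_iff in auto)
    moreover have "inj_on (cj g) (M \<inter> cent x)"
      using g subM by (intro inj_onI) (metis IntD1 cj_inject subsetD)
    ultimately show ?thesis by (simp add: card_image)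
  qed
  have orb: "card ((\<lambda>g. cj g b) ` M) = s" if b: "b \<in> cls x" for b
  proof -
    have "b \<in> carrier G" using b x cls_subset by blast
    then have "card ((\<lambda>g. cj g b) ` M) * card (M \<inter> cent x) = s * card (M \<inter> cent x)"
      using card_orbit_cj[OF sM fM, of b] card_orbit_cj[OF sM fM x(1)]
      unfolding int_eq[OF b] s_def by presburger
    moreover have "card (M \<inter> cent x) > 0"
      using x by (simp add: card_subgroup_pos subgroups_Inter_pair sM subgroup_cent)
    ultimately show ?thesis by (metis mult_cancel2 less_not_refl)
  qed
  have "s dvd card (cls x)"
    by (rule dvd_card_cj_invariant[OF sM]) (use x cls_subset subM in \<open>auto simp: orb intro: cj_mem_cls\<close>)
  moreover have "s dvd card M"
    using card_orbit_cj[OF sM fM x(1)] unfolding s_def by (metis dvd_triv_left)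
  ultimately have "s = 1" using co by (metis coprime_common_divisor_nat)
  have "m \<in> cent b" if m: "m \<in> M" and b: "b \<in> cls x" for m b
  proof -
    have bc: "b \<in> carrier G" using b x cls_subset by blast
    obtain z where z: "(\<lambda>g. cj g b) ` M = {z}"
      using orb[OF b] \<open>s = 1\<close> card_1_singletonE by blast
    moreover have "\<one> \<in> M" using sM by (simp add: subgroup.one_closed)
    ultimately have "cj m b = z" "cj \<one> b = z" using m by auto
    then show ?thesis using bc m subM by (auto simp: mem_cent_iff)
  qed
  then have "M \<subseteq> {\<one>}" using faithful_on_cls[OF x] subM by blast
  then show False using M(2) sM subgroup.one_closed by blast
qed

text \<open>The stabilizer of the pair \<open>(x, y)\<close> is the intersection of the two
  centralizers. Its index is divisible by both class sizes, hence by their product, so the orbit of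
  the pair fills \<open>cls x \<times> cls y\<close>.\<close>

lemma cls_prod_transitive:
  assumes x: "x \<in> carrier G" and y: "y \<in> carrier G"
    and co: "coprime (card (cls x)) (card (cls y))" and b: "b \<in> cls x" and c: "c \<in> cls y"
  shows "\<exists>u\<in>carrier G. cj u x = b \<and> cj u y = c"
proof -
  define \<phi> where "\<phi> g = (cj g x, cj g y)" for g
  define I where "I = {s \<in> carrier G. \<phi> s = \<phi> \<one>}"
  have I: "I = cent x \<inter> cent y" using x y by (auto simp: I_def \<phi>_def mem_cent_iff)
  have sI: "subgroup I G" unfolding I using x y by (simp add: subgroups_Inter_pair subgroup_cent)
  have "card (\<phi> ` carrier G) * card I = card (carrier G)"
    unfolding I_def using x y
    by (intro card_image_times_fibre[OF subgroup_self]) (auto simp: \<phi>_def cj_mult cj_inject)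
  moreover have d: "card (cls z) dvd k"
    if z: "z \<in> carrier G" "I \<subseteq> cent z" and k: "k * card I = card (carrier G)" for z k
  proof -
    obtain q where "card (cent z) = card I * q"
      using card_subgroup_dvd[OF sI subgroup_cent[OF z(1)] z(2)] by blast
    then have "card I * (card (cls z) * q) = card I * k"
      using card_cls_cent[OF z(1)] k by (simp add: ac_simps)
    then have "k = card (cls z) * q" using card_subgroup_pos[OF sI] by simp
    then show ?thesis by simp
  qed
  ultimately have "card (cls x) * card (cls y) dvd card (\<phi> ` carrier G)"
    using x y co I by (intro divides_mult) auto
  moreover have "card (\<phi> ` carrier G) > 0"
    using one_closed by (auto simp: card_gt_0_iff)
  ultimately have "card (cls x \<times> cls y) \<le> card (\<phi> ` carrier G)"
    by (simp add: card_cartesian_product dvd_imp_le)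
  moreover have "\<phi> ` carrier G \<subseteq> cls x \<times> cls y" by (auto simp: \<phi>_def cls_def)
  ultimately have "\<phi> ` carrier G = cls x \<times> cls y"
    using x y by (intro card_seteq) auto
  then have "(b, c) \<in> \<phi> ` carrier G" using b c by simp
  then show ?thesis by (auto simp: \<phi>_def)
qed

text \<open>By transitivity on pairs, all products of the two classes lie in the one class of
  \<open>x \<otimes> y\<close>, which therefore contains every translate of \<open>cls y\<close> by
  an element of \<open>cls x\<close>. In the case of equality all these translates coincide.\<close>

lemma card_cls_prod_gt:
  assumes x: "x \<in> carrier G" "x \<noteq> \<one>" and y: "y \<in> carrier G"
    and co: "coprime (card (cls x)) (card (cls y))"
  shows "card (cls (x \<otimes> y)) > card (cls y)"
proof -
  define D where "D = cls (x \<otimes> y)"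
  have Dc: "D \<subseteq> carrier G" "finite D" using x y cls_subset by (auto simp: D_def)
  have mem: "b \<otimes> c \<in> D" if bc: "b \<in> cls x" "c \<in> cls y" for b c
  proof -
    obtain u where "u \<in> carrier G" "cj u x = b" "cj u y = c"
      using cls_prod_transitive[OF x(1) y co bc] by blast
    then have "b \<otimes> c = cj u (x \<otimes> y)" "u \<in> carrier G" using x y by (auto simp: cj_prod)
    then show ?thesis by (simp add: D_def cls_def)
  qed
  have inj: "inj_on ((\<otimes>) b) (cls y)" if b: "b \<in> cls x" for b
    using b cls_subset[OF x(1)] cls_subset[OF y] by (intro inj_onI) (metis l_cancel subsetD)
  have sub: "(\<otimes>) b ` cls y \<subseteq> D" if "b \<in> cls x" for b using mem that by blast
  have "card (cls y) \<le> card D"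
    using card_mono[OF Dc(2) sub[OF self_mem_cls[OF x(1)]]] inj[OF self_mem_cls[OF x(1)]]
    by (simp add: card_image)
  moreover have False if eq: "card D = card (cls y)"
  proof -
    have full: "(\<otimes>) b ` cls y = D" if b: "b \<in> cls x" for b
      using Dc(2) sub[OF b] inj[OF b] eq by (intro card_subset_eq) (auto simp: card_image)
    \<comment> \<open>The left stabilizer of \<open>D\<close> is normal and acts freely on
      \<open>D\<close>, so its order divides \<open>card (cls y)\<close> and it must be trivial. Yet
      it contains \<open>b \<otimes> inv x\<close> for every \<open>b\<close> in the class of
      \<open>x\<close>.\<close>
    define T where "T = {t \<in> carrier G. \<forall>d\<in>D. t \<otimes> d \<in> D}"
    have sT: "subgroup T G"
      using Dc(1) by (intro subgroup_if_mult_closed)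
        (auto simp: T_def m_assoc subset_iff intro: finite_subset_carrier)
    moreover have "cj g t \<in> T" if g: "g \<in> carrier G" and t: "t \<in> T" for g t
    proof -
      have "cj g t \<otimes> d \<in> D" if d: "d \<in> D" for d
      proof -
        have tc: "t \<in> carrier G" "d \<in> carrier G" using t d Dc by (auto simp: T_def)
        have "cj (inv g) d \<in> D" using d g x y by (simp add: D_def cj_mem_cls)
        then have "cj g (t \<otimes> cj (inv g) d) \<in> D" using t g x y by (simp add: D_def cj_mem_cls T_def)
        then show ?thesis using g tc by (simp add: cj_prod)
      qed
      then show ?thesis using g t by (auto simp: T_def)
    qed
    ultimately have nT: "T \<lhd> G" by (simp add: normal_iff)
    have "card T dvd card D"
    proof (rule dvd_card_if_dvd_orbits[OF sT Dc(2), where a = "(\<otimes>)"])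
      fix d assume d: "d \<in> D"
      have "inj_on (\<lambda>t. t \<otimes> d) T"
        using d Dc by (intro inj_onI) (metis (no_types, lifting) T_def mem_Collect_eq r_cancel subsetD)
      then show "card T dvd card ((\<lambda>t. t \<otimes> d) ` T)" by (simp add: card_image)
    qed (use Dc(1) in \<open>auto simp: T_def m_assoc subset_iff\<close>)
    then have "coprime (card T) (card (cls x))"
      using co eq by (metis coprime_commute coprime_divisors dvd_refl)
    then have T1: "T = {\<one>}" using normal_not_coprime[OF nT _ x] by blast
    have "b = x" if b: "b \<in> cls x" for b
    proof -
      have bc: "b \<in> carrier G" using b cls_subset[OF x(1)] by blast
      have "b \<otimes> inv x \<otimes> d \<in> D" if d: "d \<in> D" for d
      proof -
        obtain c where c: "c \<in> cls y" "d = x \<otimes> c" using d full[OF self_mem_cls[OF x(1)]] by blast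
        then have "c \<in> carrier G" using cls_subset[OF y] by blast
        then have "b \<otimes> inv x \<otimes> d = b \<otimes> c" using bc x c by (simp add: m_assoc inv_mult_cancel)
        then show ?thesis using mem[OF b c(1)] by simp
      qed
      then have "b \<otimes> inv x \<in> T" using bc x by (auto simp: T_def)
      then have "b \<otimes> inv x = \<one>" using T1 by blast
      then show ?thesis using bc x by (metis inv_solve_right l_one one_closed)
    qed
    then have "cls x = {x}" using self_mem_cls[OF x(1)] by blast
    then show False using card_cls_gt_1[OF x] by simp
  qed
  ultimately show ?thesis unfolding D_def by fastforce
qed

text \<open>The class equation with the class of the identity taken out.\<close>

lemma dvd_order_minus_1:
  assumes "\<And>g. g \<in> carrier G \<Longrightarrow> g \<noteq> \<one> \<Longrightarrow> r dvd card (cls g)"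
  shows "r dvd card (carrier G) - 1"
proof -
  have inv: "cj g x \<in> carrier G - {\<one>}" if gx: "g \<in> carrier G" "x \<in> carrier G - {\<one>}" for g x
  proof -
    have "cj g x \<noteq> cj g \<one>" using gx by (subst cj_inject) simp_all
    then show ?thesis using gx by simp
  qed
  have orb: "r dvd card ((\<lambda>g. cj g x) ` carrier G)" if x: "x \<in> carrier G - {\<one>}" for x
    using x assms[of x] by (simp add: cls_def)
  have "r dvd card (carrier G - {\<one>})"
    by (rule dvd_card_cj_invariant[OF subgroup_self finite_Diff[OF finite_carrier] Diff_subset inv orb])
  moreover have "card (carrier G - {\<one>}) = card (carrier G) - 1"
    by (rule card_Diff_singleton) (rule one_closed)
  ultimately show ?thesis by argo
qed

lemma not_two_sizes:
  assumes sizes: "\<And>g. g \<in> carrier G \<Longrightarrow> g \<noteq> \<one> \<Longrightarrow> card (cls g) = m \<or> card (cls g) = n"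
    and x: "x \<in> carrier G" "x \<noteq> \<one>" "card (cls x) = m"
    and y: "y \<in> carrier G" "y \<noteq> \<one>" "card (cls y) = n"
    and mn: "m < n"
  shows False
proof -
  have "coprime m n"
  proof (rule coprimeI)
    fix r assume r: "r dvd m" "r dvd n"
    have "r dvd card (cls g)" if "g \<in> carrier G" "g \<noteq> \<one>" for g
      using sizes[OF that] r by metis
    then have "r dvd card (carrier G) - 1" by (rule dvd_order_minus_1)
    moreover have "r dvd card (cls x) * card (cent x)" unfolding x(3) using r(1) by (rule dvd_mult2)
    then have "r dvd card (carrier G)" unfolding card_cls_cent[OF x(1)] .
    ultimately have "r dvd card (carrier G) - (card (carrier G) - 1)" by (metis dvd_diff_nat)
    moreover have "card (carrier G) > 0" by (rule card_subgroup_pos[OF subgroup_self])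
    ultimately show "is_unit r" by simp
  qed
  then have gt: "card (cls (x \<otimes> y)) > n" using card_cls_prod_gt[OF x(1,2) y(1)] unfolding x(3) y(3) by blast
  have "x \<otimes> y \<noteq> \<one>"
  proof
    assume "x \<otimes> y = \<one>"
    moreover have "cls \<one> \<subseteq> {\<one>}" by (auto simp: cls_def)
    then have "card (cls \<one>) \<le> 1"
      using card_mono[of "{\<one>}" "cls \<one>"] by simp
    ultimately show False using gt card_cls_gt_1[OF y(1,2)] unfolding y(3) by simp
  qed
  then show False using sizes[OF m_closed[OF x(1) y(1)]] gt mn by linarith
qed

end

section \<open>Conjugacy classes of prime size\<close>

context finite_prime_group
begin

lemma mem_cls_carrier: "b \<in> cls x \<Longrightarrow> x \<in> carrier G \<Longrightarrow> b \<in> carrier G"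
  using cls_subset by blast

lemma card_cls_one: "card (cls \<one>) = 1"
proof -
  have "cls \<one> \<subseteq> {\<one>}" by (auto simp: cls_def)
  then have "cls \<one> = {\<one>}" using self_mem_cls[OF one_closed] by blast
  then show ?thesis by simp
qed

end

text \<open>\<open>y\<close> is a parameter so that the locale can be instantiated again with any
  other nontrivial element of \<open>P\<close>.\<close>

locale prime_class = finite_prime_group +
  fixes p :: nat and x y :: 'a and P :: "'a set"
  assumes prime_p: "prime p" and x [simp]: "x \<in> carrier G" and card_cls_x: "card (cls x) = p"
    and P: "subgroup P G" and card_P: "card P = p" and y: "y \<in> P" "y \<noteq> \<one>"
begin

lemma p_gt_1: "p > 1"
  using prime_p prime_gt_1_nat by blast

lemma x_not_one: "x \<noteq> \<one>"
  using card_cls_x card_cls_one p_gt_1 by force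

lemma P_carrier: "P \<subseteq> carrier G"
  using P subgroup.subset by blast

lemma y_carrier [simp]: "y \<in> carrier G"
  using y P_carrier by blast

lemma finite_P: "finite P"
  using P finite_subgroup by blast

lemma P_subset:
  assumes K: "subgroup K G" and g: "g \<in> P" "g \<in> K" "g \<noteq> \<one>"
  shows "P \<subseteq> K"
proof -
  have sub: "subgroup (P \<inter> K) G" using P K subgroups_Inter_pair by blast
  then have "card (P \<inter> K) dvd p" using card_subgroup_dvd[OF sub P] card_P by simp
  moreover have "card (P \<inter> K) \<noteq> 1"
  proof
    assume "card (P \<inter> K) = 1"
    then obtain z where "P \<inter> K = {z}" using card_1_singletonE by blast
    moreover have "\<one> \<in> P \<inter> K" using sub subgroup.one_closed by blast
    ultimately show False using g by (metis IntI singletonD)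
  qed
  ultimately have "card (P \<inter> K) = card P" using prime_p unfolding card_P prime_nat_iff by blast
  then have "P \<inter> K = P" by (intro card_subset_eq finite_P) auto
  then show ?thesis by blast
qed

lemma P_powers: "g \<in> P \<Longrightarrow> \<exists>i::int. g = y [^] i"
proof -
  assume g: "g \<in> P"
  define Q where "Q = range (\<lambda>i::int. y [^] i)"
  have "subgroup Q G"
  proof (rule subgroupI)
    show "Q \<subseteq> carrier G" "Q \<noteq> {}" by (auto simp: Q_def)
    show "inv a \<in> Q" if "a \<in> Q" for a
      using that by (auto simp: Q_def simp flip: int_pow_neg)
    show "a \<otimes> b \<in> Q" if "a \<in> Q" "b \<in> Q" for a b
      using that by (auto simp: Q_def simp flip: int_pow_mult)
  qed
  moreover have "y \<in> Q" unfolding Q_def by (rule range_eqI[of _ _ 1]) simp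
  ultimately have "P \<subseteq> Q" using P_subset y by blast
  then show ?thesis using g by (auto simp: Q_def)
qed

lemma pow_mem_P [simp]: "y [^] (i::int) \<in> P"
  using P y subgroup_int_pow_closed by blast

lemma ord_y: "ord y = p"
proof -
  have "subgroup (generate G {y}) G" "generate G {y} \<subseteq> P"
    using generate_is_subgroup generate_subgroup_incl P y by auto
  then have "ord y dvd p"
    using card_subgroup_dvd[OF _ P] card_P generate_pow_card by simp
  moreover have "ord y \<noteq> 1" using y ord_eq_1 by simp
  ultimately show ?thesis using prime_p unfolding prime_nat_iff by blast
qed

lemma pow_eq_iff: "y [^] (i::int) = y [^] j \<longleftrightarrow> int p dvd j - i"
  using int_pow_eq ord_y by simp

lemma P_commute: "g \<in> P \<Longrightarrow> k \<in> P \<Longrightarrow> g \<otimes> k = k \<otimes> g"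
  by (metis P_powers add.commute int_pow_mult y_carrier)

lemma not_centralized:
  assumes x': "x' \<in> carrier G" "x' \<noteq> \<one>"
  shows "\<exists>b\<in>cls x'. \<not> P \<subseteq> cent b"
  using faithful_on_cls[OF x' y_carrier] y by blast

lemma dvd_card_not_centralized:
  assumes x': "x' \<in> carrier G"
  shows "p dvd card {b \<in> cls x'. \<not> P \<subseteq> cent b}"
  using P_carrier x' cj_mem_cls[OF x']
  by (intro dvd_card_nonfixed[OF P card_P prime_p finite_cls[OF x'] cls_subset[OF x']]) blast

text \<open>By faithfulness \<open>P\<close> moves some element of the class, and the number of
  elements that it moves is a multiple of \<open>p\<close>.\<close>

lemma le_card_cls:
  assumes x': "x' \<in> carrier G" "x' \<noteq> \<one>"
  shows "p \<le> card (cls x')"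
proof -
  have "card {b \<in> cls x'. \<not> P \<subseteq> cent b} > 0"
    using not_centralized[OF x'] finite_cls[OF x'(1)] by (auto simp: card_gt_0_iff)
  then have "p \<le> card {b \<in> cls x'. \<not> P \<subseteq> cent b}"
    using dvd_card_not_centralized[OF x'(1)] dvd_imp_le by blast
  also have "\<dots> \<le> card (cls x')" using x' by (intro card_mono) auto
  finally show ?thesis .
qed

text \<open>\<open>P\<close> moves a positive multiple of \<open>p\<close> elements of this class,
  hence all \<open>p\<close> of them. So \<open>P\<close> acts regularly on it.\<close>

lemma P_Int_cent:
  assumes "b \<in> cls x"
  shows "P \<inter> cent b = {\<one>}"
proof -
  have b: "b \<in> carrier G" using assms mem_cls_carrier by simp
  have "card {b \<in> cls x. \<not> P \<subseteq> cent b} > 0"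
    using not_centralized[OF x x_not_one] by (auto simp: card_gt_0_iff)
  then have "p \<le> card {b \<in> cls x. \<not> P \<subseteq> cent b}"
    using dvd_card_not_centralized[OF x] dvd_imp_le by blast
  then have "{b \<in> cls x. \<not> P \<subseteq> cent b} = cls x"
    using card_cls_x by (intro card_seteq) auto
  then have "\<not> P \<subseteq> cent b" using assms by blast
  then have "P \<inter> cent b \<subseteq> {\<one>}" using P_subset[OF subgroup_cent[OF b]] by blast
  then show ?thesis using P subgroup_cent[OF b] subgroup.one_closed by blast
qed

text \<open>Numbers the conjugates of \<open>x\<close>, called points, by integers modulo
  \<open>p\<close> such that \<open>y\<close> acts as the shift by \<open>1\<close>. Integer indices
  match the polynomial argument for permutations of prime degree.\<close>

definition pt :: "int \<Rightarrow> 'a" where "pt i = cj (y [^] i) x"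

lemma pt_0 [simp]: "pt 0 = x"
  by (simp add: pt_def)

lemma pt_carrier [simp]: "pt i \<in> carrier G"
  by (simp add: pt_def)

lemma cls_pt [simp]: "cls (pt i) = cls x"
  by (simp add: pt_def cls_cj)

lemma pt_mem_cls: "pt i \<in> cls x"
  using self_mem_cls[of "pt i"] by simp

lemma cj_pow_pt: "cj (y [^] j) (pt i) = pt (j + i)"
  by (simp add: pt_def int_pow_mult flip: cj_mult)

lemma pt_eq_iff: "pt i = pt j \<longleftrightarrow> int p dvd i - j"
proof -
  have "pt i = cj (y [^] j) (pt (i - j))" "pt j = cj (y [^] j) (pt 0)" by (simp_all only: cj_pow_pt) simp_all
  then have "pt i = pt j \<longleftrightarrow> pt (i - j) = x" by (simp add: cj_inject)
  also have "\<dots> \<longleftrightarrow> y [^] (i - j) \<in> P \<inter> cent x" by (simp add: pt_def mem_cent_iff)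
  also have "\<dots> \<longleftrightarrow> y [^] (i - j) = y [^] (0::int)"
    using P_Int_cent[OF self_mem_cls[OF x]] by simp
  also have "\<dots> \<longleftrightarrow> int p dvd i - j" unfolding pow_eq_iff by (simp add: dvd_diff_commute)
  finally show ?thesis .
qed

lemma cls_is_pt: "b \<in> cls x \<Longrightarrow> \<exists>i. b = pt i"
proof -
  assume b: "b \<in> cls x"
  have "card ((\<lambda>g. cj g x) ` P) = p"
    using card_orbit_cj[OF P finite_P x] P_Int_cent[OF self_mem_cls[OF x]] card_P by simp
  moreover have "(\<lambda>g. cj g x) ` P \<subseteq> cls x" using P_carrier by (auto simp: cls_def)
  ultimately have "(\<lambda>g. cj g x) ` P = cls x" using card_cls_x by (intro card_subset_eq) auto
  then show ?thesis using b P_powers by (fastforce simp: pt_def)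
qed

lemma eq_one_if_fixes_pts:
  assumes "g \<in> carrier G" "\<And>i. cj g (pt i) = pt i"
  shows "g = \<one>"
proof (rule faithful_on_cls[OF x x_not_one assms(1)])
  fix b assume "b \<in> cls x"
  then obtain i where "b = pt i" using cls_is_pt by blast
  then show "g \<in> cent b" using assms by (simp add: mem_cent_iff)
qed

lemma cj_pt_ex: "g \<in> carrier G \<Longrightarrow> \<exists>j. cj g (pt i) = pt j"
  using cls_is_pt cj_mem_cls[OF x _ pt_mem_cls] by blast

text \<open>An element commuting with \<open>y\<close>, followed by the power of \<open>y\<close>
  that brings the image of \<open>x\<close> back, fixes \<open>x\<close> and therefore every point.
  By faithfulness this product is trivial.\<close>

lemma cent_y: "cent y = P"
proof (intro equalityI subsetI)
  fix g assume "g \<in> P"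
  then show "g \<in> cent y" using P_commute y P_carrier by (auto simp: cent_def)
next
  fix g assume g: "g \<in> cent y"
  then have gc: "g \<in> carrier G" using cent_subset by blast
  have P_cent: "k \<otimes> y [^] i = y [^] i \<otimes> k" if k: "k \<in> cent y" for k and i :: int
  proof -
    have kc: "k \<in> carrier G" using k cent_subset by blast
    have "y \<in> cent k" using k kc by (simp add: cent_commute)
    then have "y [^] i \<in> cent k" using subgroup_int_pow_closed[OF subgroup_cent[OF kc]] by blast
    then show ?thesis by (simp add: cent_def)
  qed
  obtain i where i: "cj g x = pt i" using cj_pt_ex[OF gc, of 0] by auto
  define k where "k = y [^] (- i) \<otimes> g"
  have kc: "k \<in> carrier G" using gc by (simp add: k_def)
  have "y [^] (- i) \<in> cent y" using subgroup_int_pow_closed[OF subgroup_cent] self_mem_cent by auto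
  then have k: "k \<in> cent y" using g subgroup.m_closed[OF subgroup_cent] by (simp add: k_def)
  have kx: "cj k x = x" using gc i by (simp add: k_def cj_mult cj_pow_pt)
  have "cj k (pt j) = pt j" for j
  proof -
    have "cj k (pt j) = cj (k \<otimes> y [^] j) x" using kc by (simp add: pt_def cj_mult)
    also have "\<dots> = cj (y [^] j) (cj k x)" unfolding P_cent[OF k] using kc by (simp add: cj_mult)
    finally show ?thesis unfolding kx by (simp add: pt_def)
  qed
  then have "k = \<one>" using eq_one_if_fixes_pts kc by blast
  then have "g = y [^] i" using gc unfolding k_def
    by (simp add: int_pow_neg) (metis int_pow_closed inv_equality inv_inv y_carrier inv_closed inv_comm)
  then show "g \<in> P" by simp
qed

section \<open>Counting the conjugates of \<open>y\<close>\<close>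

lemma card_cls_y: "card (cls y) * p = card (carrier G)"
  using card_cls_cent[of y] cent_y card_P by simp

lemma card_cent_if_card_cls:
  assumes "z \<in> carrier G" "card (cls z) = p"
  shows "card (cent z) = card (cls y)"
proof -
  have "p * card (cent z) = p * card (cls y)"
    using card_cls_cent[OF assms(1)] assms(2) card_cls_y by (simp add: mult.commute)
  then show ?thesis using p_gt_1 by simp
qed

text \<open>If \<open>z\<close> is the \<open>j\<close>-th power of \<open>y\<close>, then taking
  \<open>j\<close>-th powers maps one intersection injectively into the other, as \<open>j\<close>
  is invertible modulo \<open>p\<close>.\<close>

lemma card_Int_le:
  assumes z: "z \<in> P" "z \<noteq> \<one>"
  shows "card (cls y \<inter> P) \<le> card (cls z \<inter> P)"
proof -
  obtain j :: int where j: "z = y [^] j" using P_powers z by blast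
  have nj: "\<not> int p dvd j" using z(2) j pow_eq_iff[of j 0] by auto
  have "inj_on (\<lambda>c. c [^] j) (cls y \<inter> P)"
  proof (rule inj_onI)
    fix c c' assume c: "c \<in> cls y \<inter> P" "c' \<in> cls y \<inter> P" "c [^] j = c' [^] j"
    then obtain a b :: int where ab: "c = y [^] a" "c' = y [^] b" using P_powers by blast
    then have "y [^] (a * j) = y [^] (b * j)" using c(3) by (simp add: int_pow_pow)
    then have "int p dvd (b - a) * j" unfolding pow_eq_iff by (simp add: algebra_simps)
    then have "int p dvd b - a" using nj prime_p by (simp add: prime_dvd_mult_iff)
    then show "c = c'" using ab pow_eq_iff by simp
  qed
  moreover have "(\<lambda>c. c [^] j) ` (cls y \<inter> P) \<subseteq> cls z \<inter> P"
  proof clarify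
    fix c assume c: "c \<in> cls y" "c \<in> P"
    then obtain g where g: "g \<in> carrier G" "c = cj g y" by (auto simp: cls_def)
    have "(\<lambda>u. cj g u) \<in> hom G G" using g by (auto simp: hom_def cj_prod)
    then have "cj g (y [^] j) = c [^] j" using g by (simp add: hom_int_pow is_group)
    then have "c [^] j \<in> cls z" using g(1) j unfolding cls_def by (metis imageI)
    then show "c [^] j \<in> cls z \<inter> P" using c subgroup_int_pow_closed[OF P] by simp
  qed
  ultimately show ?thesis using finite_P by (intro card_inj_on_le) auto
qed

text \<open>By \<open>card_Int_le\<close> with \<open>y\<close> and \<open>z\<close> exchanged, the
  classes cut the nontrivial part of \<open>P\<close> into pieces of equal size. That size is the
  index of \<open>P\<close> in its normalizer.\<close>

lemma card_Int_dvd: "card (cls y \<inter> P) dvd p - 1"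
proof -
  have eq: "card (cls z \<inter> P) = card (cls y \<inter> P)" if z: "z \<in> P - {\<one>}" for z
  proof -
    interpret z: prime_class G p x z P
      by (intro prime_class.intro prime_class_axioms.intro finite_prime_group_axioms)
        (use z in \<open>simp_all add: prime_p card_cls_x P card_P\<close>)
    show ?thesis using card_Int_le[of z] z.card_Int_le[of y] z y by simp
  qed
  have "card (cls y \<inter> P) dvd card (\<Union>z\<in>P - {\<one>}. cls z \<inter> P)"
  proof (rule dvd_partition)
    show "\<forall>c1\<in>(\<lambda>z. cls z \<inter> P) ` (P - {\<one>}). \<forall>c2\<in>(\<lambda>z. cls z \<inter> P) ` (P - {\<one>}). c1 \<noteq> c2 \<longrightarrow> c1 \<inter> c2 = {}"
    proof (intro ballI impI, rule ccontr)
      fix c1 c2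
      assume "c1 \<in> (\<lambda>z. cls z \<inter> P) ` (P - {\<one>})" "c2 \<in> (\<lambda>z. cls z \<inter> P) ` (P - {\<one>})"
        and ne: "c1 \<noteq> c2" and "c1 \<inter> c2 \<noteq> {}"
      then obtain z1 z2 b where z: "z1 \<in> P" "z2 \<in> P" "c1 = cls z1 \<inter> P" "c2 = cls z2 \<inter> P"
        "b \<in> cls z1" "b \<in> cls z2" by blast
      then have "cls z1 = cls z2" using cls_eq P_carrier by (metis subsetD)
      then show False using ne z by simp
    qed
  qed (use eq finite_P in auto)
  moreover have "(\<Union>z\<in>P - {\<one>}. cls z \<inter> P) = P - {\<one>}"
  proof -
    have "\<one> \<notin> cls z" if z: "z \<in> P - {\<one>}" for z
    proof
      assume "\<one> \<in> cls z"
      then have "cls \<one> = cls z" using z P_carrier cls_eq by blast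
      then have "card (cls z) = 1" using card_cls_one by simp
      then show False using card_cls_gt_1[of z] z P_carrier by auto
    qed
    moreover have "z \<in> cls z" if "z \<in> P" for z using that P_carrier self_mem_cls by blast
    ultimately show ?thesis by blast
  qed
  moreover have "card (P - {\<one>}) = p - 1"
    using card_Diff_singleton[OF subgroup.one_closed[OF P]] card_P by simp
  ultimately show ?thesis by simp
qed

text \<open>A normal \<open>P\<close> would commute elementwise with itself, being abelian, and so
  be trivial.\<close>

lemma P_not_normal: "\<exists>g\<in>carrier G. cj g y \<notin> P"
proof (rule ccontr)
  assume contr: "\<not> ?thesis"
  have "cj g k \<in> P" if g: "g \<in> carrier G" and k: "k \<in> P" for g k
  proof -
    obtain j :: int where j: "k = y [^] j" using P_powers k by blast
    have "(\<lambda>u. cj g u) \<in> hom G G" using g by (auto simp: hom_def cj_prod)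
    then have "cj g (y [^] j) = cj g y [^] j" using g by (simp add: hom_int_pow is_group)
    then show ?thesis using contr g j subgroup_int_pow_closed[OF P] by simp
  qed
  then have "P \<lhd> G" using P by (simp add: normal_iff)
  then have "P = {\<one>}" using prime_normal[of P P] P_commute by blast
  then show False using y by blast
qed

text \<open>\<open>P\<close> acts on the class of \<open>y\<close>, and its fixed points there are
  the members of \<open>cent y = P\<close>.\<close>

lemma card_cls_y_cong:
  defines "e \<equiv> card (cls y \<inter> P)"
  shows "1 \<le> e" "e < p" "p dvd card (cls y) - e" "e < card (cls y)"
proof -
  have yP: "y \<in> cls y \<inter> P" using y self_mem_cls by simp
  then have "card (cls y \<inter> P) > 0" using finite_P by (auto simp: card_gt_0_iff)
  then show "1 \<le> e" by (simp add: e_def)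
  have "e \<le> p - 1" unfolding e_def using card_Int_dvd p_gt_1 by (intro dvd_imp_le) auto
  then show "e < p" using p_gt_1 by simp
  have "{c \<in> cls y. \<not> P \<subseteq> cent c} = cls y - cls y \<inter> P"
  proof -
    have "P \<subseteq> cent c \<longleftrightarrow> c \<in> P" if c: "c \<in> cls y" for c
    proof -
      have cc: "c \<in> carrier G" using c mem_cls_carrier by simp
      have "P \<subseteq> cent c \<longleftrightarrow> y \<in> cent c" using P_subset[OF subgroup_cent[OF cc]] y by blast
      also have "\<dots> \<longleftrightarrow> c \<in> P" using cc cent_y cent_commute by simp
      finally show ?thesis .
    qed
    then show ?thesis by blast
  qed
  then have "p dvd card (cls y - cls y \<inter> P)" using dvd_card_not_centralized[OF y_carrier] by simp
  then show "p dvd card (cls y) - e"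
    using finite_P by (simp add: e_def card_Diff_subset)
  have "cls y \<inter> P \<subset> cls y" using P_not_normal by (auto simp: cls_def)
  then show "e < card (cls y)" unfolding e_def by (intro psubset_card_mono) auto
qed

lemma card_cls_y_gt: "card (cls y) > p"
proof -
  have "p \<le> card (cls y) - card (cls y \<inter> P)" using card_cls_y_cong by (intro dvd_imp_le) auto
  then show ?thesis using card_cls_y_cong by linarith
qed

lemma coprime_p_card_cls_y: "coprime p (card (cls y))"
proof -
  have "\<not> p dvd card (cls y)"
  proof
    assume "p dvd card (cls y)"
    then have "p dvd card (cls y) - (card (cls y) - card (cls y \<inter> P))"
      using card_cls_y_cong(3) by (rule dvd_diff_nat)
    then have "p dvd card (cls y \<inter> P)" using card_cls_y_cong(4) by simp
    then show False using card_cls_y_cong(1,2) by (meson dvd_imp_le le_trans linorder_not_le less_le_trans zero_less_one)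
  qed
  then show ?thesis using prime_p prime_imp_coprime by blast
qed

section \<open>Double transitivity on the points\<close>

lemma normalizes_P_if_affine:
  assumes g: "g \<in> carrier G" and f: "\<And>i. cj g (pt i) = pt (f i)"
    and aff: "\<And>i. int p dvd f i - (a * i + b)"
  shows "cj g y \<in> P"
proof -
  define w where "w = cj g y"
  have wc: "w \<in> carrier G" using g by (simp add: w_def)
  \<comment> \<open>An affine map with slope \<open>a\<close> conjugates the shift by
    \<open>1\<close>, which is \<open>y\<close>, into the shift by \<open>a\<close>, which is a
    power of \<open>y\<close>.\<close>
  have step: "cj w (pt (f i)) = pt (a + f i)" for i
  proof -
    have "w \<otimes> g = g \<otimes> y" using g by (simp add: w_def cj_def m_assoc)
    then have "cj w (cj g (pt i)) = cj g (cj y (pt i))"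
      using g wc by (simp flip: cj_mult)
    also have "cj y (pt i) = pt (1 + i)" using cj_pow_pt[of 1 i] by simp
    finally have "cj w (pt (f i)) = pt (f (1 + i))" by (simp add: f)
    moreover have "int p dvd (f (1 + i) - (a * (1 + i) + b)) - (f i - (a * i + b))"
      by (rule dvd_diff[OF aff aff])
    then have "int p dvd f (1 + i) - (a + f i)" by (simp add: algebra_simps)
    ultimately show ?thesis by (simp add: pt_eq_iff)
  qed
  have "y [^] (- a) \<otimes> w = \<one>"
  proof (rule eq_one_if_fixes_pts)
    fix j
    obtain i where "cj (inv g) (pt j) = pt i" using cj_pt_ex g by blast
    then have "pt j = pt (f i)" using g f by (metis cj_inv_right pt_carrier)
    then show "cj (y [^] (- a) \<otimes> w) (pt j) = pt j"
      using wc by (simp add: cj_mult step cj_pow_pt)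
  qed (use wc in simp)
  then have "w = y [^] a" using wc
    by (simp add: int_pow_neg) (metis int_pow_closed inv_equality inv_inv y_carrier inv_closed inv_comm)
  then show ?thesis by (simp add: w_def)
qed

text \<open>Burnside's theorem. Otherwise the nonzero residues split into two nonempty sets
  invariant under the stabilizer of \<open>x\<close>. All group elements preserve the differences
  lying in the smaller set, so they act affinely and normalize \<open>P\<close>.\<close>

lemma two_transitive:
  assumes j: "\<not> int p dvd j"
  shows "\<exists>g\<in>cent x. cj g (pt 1) = pt j"
proof (rule ccontr)
  assume contr: "\<not> ?thesis"
  define orb where "orb j \<longleftrightarrow> (\<exists>g\<in>cent x. cj g (pt 1) = pt j)" for j
  have p1: "int p > 1" using p_gt_1 by simp
  have mod_range: "i mod int p \<in> {1..<int p}" if i: "\<not> int p dvd i" for i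
  proof -
    have "i mod int p \<noteq> 0" using i by (simp add: dvd_eq_mod_eq_0)
    moreover have "0 \<le> i mod int p" "i mod int p < int p" using p1 by simp_all
    ultimately have "1 \<le> i mod int p" by linarith
    then show ?thesis using \<open>i mod int p < int p\<close> by simp
  qed
  have orb_cong: "orb i \<longleftrightarrow> orb i'" if "int p dvd i - i'" for i i'
    using that pt_eq_iff by (metis orb_def)
  have pt_mod: "pt (i mod int p) = pt i" for i
    by (simp add: pt_eq_iff dvd_diff_commute dvd_minus_mod)
  have orb_mod: "orb (i mod int p) \<longleftrightarrow> orb i" for i
    by (rule orb_cong) (simp add: dvd_diff_commute dvd_minus_mod)
  have orb_inv: "orb i' \<longleftrightarrow> orb i" if g: "g \<in> cent x" "cj g (pt i) = pt i'" for g i i'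
  proof
    assume "orb i"
    then obtain k where "k \<in> cent x" "cj k (pt 1) = pt i" by (auto simp: orb_def)
    then have "cj (g \<otimes> k) (pt 1) = pt i'" "g \<otimes> k \<in> cent x"
      using g cent_subset subgroup.m_closed[OF subgroup_cent[OF x]] by (auto simp: cj_mult subset_iff)
    then show "orb i'" by (auto simp: orb_def)
  next
    assume "orb i'"
    then obtain k where k: "k \<in> cent x" "cj k (pt 1) = pt i'" by (auto simp: orb_def)
    have c: "g \<in> carrier G" "k \<in> carrier G" using g k cent_subset by auto
    have "cj (inv g \<otimes> k) (pt 1) = cj (inv g) (cj k (pt 1))" using c by (simp add: cj_mult)
    also have "\<dots> = cj (inv g) (cj g (pt i))" unfolding k(2) g(2) ..
    also have "\<dots> = pt i" using c by simp
    finally have "cj (inv g \<otimes> k) (pt 1) = pt i" .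
    moreover have "inv g \<otimes> k \<in> cent x"
      using g k by (simp add: subgroup.m_closed subgroup.m_inv_closed subgroup_cent)
    ultimately show "orb i" by (auto simp: orb_def)
  qed
  \<comment> \<open>\<open>A\<close> is the orbit of \<open>1\<close> and \<open>B\<close> the rest.
    Their sizes add up to \<open>p - 1\<close>, so one of them is below half of
    \<open>p\<close>.\<close>
  define A where "A = {d \<in> {1..<int p}. orb d}"
  define B where "B = {d \<in> {1..<int p}. \<not> orb d}"
  have "orb 1" unfolding orb_def using subgroup.one_closed[OF subgroup_cent[OF x]]
    by (intro bexI[of _ \<one>]) auto
  then have "1 \<in> A" using p1 by (simp add: A_def)
  then have A_ne: "A \<noteq> {}" by blast
  have "\<not> orb (j mod int p)" using contr orb_mod by (simp add: orb_def)
  moreover have "j mod int p \<in> {1..<int p}"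
    using mod_range[OF j] .
  ultimately have "j mod int p \<in> B" by (simp add: B_def)
  then have B_ne: "B \<noteq> {}" by blast
  have "card A + card B = card (A \<union> B)"
  proof (rule card_Un_disjoint[symmetric])
    show "finite A" "finite B" by (rule finite_subset[of _ "{1..<int p}"]; auto simp: A_def B_def)+
  qed (auto simp: A_def B_def)
  also have "A \<union> B = {1..<int p}" by (auto simp: A_def B_def)
  finally have "int (card A) + int (card B) = int p - 1" using p1 by simp
  then have "2 * int (card A) < int p \<or> 2 * int (card B) < int p" by linarith
  then obtain S where S: "S \<noteq> {}" "S \<subseteq> {1..<int p}" "2 * int (card S) < int p" "S = A \<or> S = B"
    using A_ne B_ne by (metis (no_types, lifting) A_def B_def mem_Collect_eq subsetI)
  have S_inv: "i' mod int p \<in> S" if g: "g \<in> cent x" "cj g (pt d) = pt i'" and d: "d \<in> S" for g d i'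
  proof -
    have "\<not> int p dvd i'"
    proof
      assume "int p dvd i'"
      then have "pt i' = pt 0" by (simp add: pt_eq_iff del: pt_0)
      then have "cj g (pt d) = cj g (pt 0)" using g by (simp add: mem_cent_iff)
      then have "pt d = pt 0" using cj_inject[OF subsetD[OF cent_subset g(1)], of "pt d" "pt 0"] by (simp del: pt_0)
      then have "int p dvd d" by (simp add: pt_eq_iff del: pt_0)
      then show False using d S(2) zdvd_imp_le[of "int p" d] by auto
    qed
    then have "i' mod int p \<in> {1..<int p}"
      by (rule mod_range)
    then show ?thesis using S(4) d orb_inv[OF g] orb_mod[of i'] by (auto simp: A_def B_def)
  qed
  have "cj g y \<in> P" if g: "g \<in> carrier G" for g
  proof -
    obtain f where f: "\<And>i. cj g (pt i) = pt (f i)" using cj_pt_ex[OF g] by metis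
    have f_eq: "int p dvd f i - f j \<longleftrightarrow> int p dvd i - j" for i j
      unfolding pt_eq_iff[symmetric] f[symmetric] using g by (simp add: cj_inject)
    have "\<exists>a b. \<forall>i. int p dvd f i - (a * i + b)"
    proof (rule affine_if_preserves_differences[where S = S])
      fix i d assume d: "d \<in> S"
      \<comment> \<open>Shifting \<open>pt i\<close> to \<open>x\<close> before applying
        \<open>g\<close>, and its image back to \<open>x\<close> afterwards, gives an element of the
        stabilizer of \<open>x\<close> that sends \<open>pt d\<close> to
        \<open>pt (f (i + d) - f i)\<close>.\<close>
      define k where "k = y [^] (- f i) \<otimes> (g \<otimes> y [^] i)"
      have "cj k (pt j) = pt (f (i + j) - f i)" for j
        using g by (simp add: k_def cj_mult cj_pow_pt f)
      note this[of 0] this[of d]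
      moreover have "k \<in> carrier G" using g by (simp add: k_def)
      ultimately show "(f (i + d) - f i) mod int p \<in> S"
        using d by (intro S_inv[of k d]) (simp_all add: mem_cent_iff)
    qed (use S f_eq prime_p in auto)
    then show ?thesis using normalizes_P_if_affine[OF g f] by blast
  qed
  then show False using P_not_normal by blast
qed

text \<open>By double transitivity, commuting with one further point would mean commuting with all
  of them, as \<open>cent x\<close> fixes \<open>x\<close>.\<close>

lemma not_commute_pt:
  assumes j: "\<not> int p dvd j"
  shows "x \<notin> cent (pt j)"
proof
  assume c: "x \<in> cent (pt j)"
  have conj: "x \<in> cent (cj g z) \<longleftrightarrow> x \<in> cent z" if g: "g \<in> cent x" and z: "z \<in> carrier G" for g z
  proof -
    have "cj g x = x" "g \<in> carrier G" using g by (auto simp: mem_cent_iff)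
    then show ?thesis using mem_cent_cj_iff[of g z x] z by simp
  qed
  obtain g where g: "g \<in> cent x" "cj g (pt 1) = pt j" using two_transitive[OF j] by blast
  then have c1: "x \<in> cent (pt 1)" using c conj[OF g(1), of "pt 1"] by simp
  have "x \<in> cent (pt i)" for i
  proof (cases "int p dvd i")
    case True
    then have "pt i = pt 0" by (simp add: pt_eq_iff del: pt_0)
    then show ?thesis by (simp add: self_mem_cent)
  next
    case False
    then obtain k where k: "k \<in> cent x" "cj k (pt 1) = pt i" using two_transitive by blast
    then show ?thesis using c1 conj[OF k(1), of "pt 1"] by simp
  qed
  then have "x = \<one>" by (intro eq_one_if_fixes_pts) (simp_all add: mem_cent_iff)
  then show False using x_not_one by blast
qed

section \<open>The stabilizer of two points\<close>

definition W :: "'a set" where "W = cent x \<inter> cent (pt 1)"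

lemma subgroup_W: "subgroup W G"
  unfolding W_def by (simp add: subgroups_Inter_pair subgroup_cent)

lemma card_W_pos: "card W > 0"
  using card_subgroup_pos[OF subgroup_W] .

lemma not_dvd_1: "\<not> int p dvd 1"
  using p_gt_1 by simp

text \<open>\<open>cent x\<close> has order \<open>card (cls y)\<close> and is transitive on the
  other \<open>p - 1\<close> points, with \<open>W\<close> as stabilizer of one of them.\<close>

lemma card_W: "(p - 1) * card W = card (cls y)"
proof -
  have "(\<lambda>g. cj g (pt 1)) ` cent x = cls x - {x}"
  proof (intro equalityI subsetI)
    fix b assume "b \<in> (\<lambda>g. cj g (pt 1)) ` cent x"
    then obtain g where g: "g \<in> cent x" "b = cj g (pt 1)" by blast
    have gc: "g \<in> carrier G" using g cent_subset by blast
    have "cj g (pt 1) \<noteq> cj g (pt 0)"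
      using cj_inject[OF gc, of "pt 1" "pt 0"] not_dvd_1 pt_eq_iff[of 1 0] by (simp del: pt_0)
    then have "b \<noteq> x" using g by (simp add: mem_cent_iff)
    then show "b \<in> cls x - {x}" using g gc cj_mem_cls[OF x gc pt_mem_cls] by simp
  next
    fix b assume b: "b \<in> cls x - {x}"
    then obtain j where j: "b = pt j" using cls_is_pt by blast
    then have "pt j \<noteq> pt 0" using b by simp
    then have "\<not> int p dvd j" unfolding pt_eq_iff by simp
    then show "b \<in> (\<lambda>g. cj g (pt 1)) ` cent x" using two_transitive j by force
  qed
  moreover have "card (cls x - {x}) = p - 1"
    using card_Diff_singleton[OF self_mem_cls[OF x]] card_cls_x by simp
  moreover have "card ((\<lambda>g. cj g (pt 1)) ` cent x) * card (cent x \<inter> cent (pt 1)) = card (cent x)"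
    by (rule card_orbit_cj) (simp_all add: subgroup_cent)
  ultimately show ?thesis using card_cent_if_card_cls[OF x card_cls_x] by (simp add: W_def)
qed

lemma card_W_not_1: "card W \<noteq> 1"
proof
  assume "card W = 1"
  then have "card (cls y) = p - 1" using card_W by (metis mult.right_neutral)
  then show False using card_cls_y_gt by linarith
qed

text \<open>As \<open>p\<close> is the least nontrivial class size, no nontrivial element has a
  centralizer larger than a point stabilizer.\<close>

lemma cent_eq_if_subset:
  assumes b: "b \<in> cls x" and d: "d \<in> carrier G" "d \<noteq> \<one>" and sub: "cent b \<subseteq> cent d"
  shows "cent d = cent b"
proof -
  have bc: "b \<in> carrier G" using b mem_cls_carrier by simp
  have "card (cls b) = p" using cls_eq[OF x b] card_cls_x by simp
  then have cb: "card (cent b) = card (cls y)" using card_cent_if_card_cls bc by blast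
  have "p * card (cent d) \<le> card (cls d) * card (cent d)" using le_card_cls[OF d] by simp
  also have "\<dots> = p * card (cls y)" using card_cls_cent[OF d(1)] card_cls_y by (simp add: mult.commute)
  finally have "card (cent d) \<le> card (cent b)" using cb p_gt_1 by simp
  then show ?thesis using sub by (intro card_seteq[symmetric]) auto
qed

section \<open>Products of elements whose centralizers are point stabilizers\<close>

lemma cent_prod:
  assumes k: "k \<in> cent u" and u: "u \<in> carrier G" "v \<in> carrier G"
  shows "k \<in> cent (u \<otimes> v) \<longleftrightarrow> k \<in> cent v"
proof -
  have kc: "k \<in> carrier G" "cj k u = u" using k u by (auto simp: mem_cent_iff)
  then show ?thesis using u by (simp add: mem_cent_iff cj_prod)
qed

text \<open>The centralizer of the product meets \<open>cent x\<close> in \<open>W\<close> and is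
  strictly larger than \<open>W\<close>. It has order \<open>(p - 1) * card W\<close> if the class
  size is \<open>p\<close>, and at most \<open>p\<close> otherwise, where counting yields the
  impossible \<open>card W = 1\<close>.\<close>

lemma cent_prod_of_two_pts:
  assumes sizes: "\<And>g. g \<in> carrier G \<Longrightarrow> g \<noteq> \<one> \<Longrightarrow>
      card (cls g) = p \<or> card (cls g) = card (cls y) \<or> card (cls g) > card (cls y)"
    and z: "z \<in> carrier G" "cent z = cent x" and z': "z' \<in> carrier G" "cent z' = cent (pt 1)"
  shows "\<exists>b\<in>cls x. cent (z \<otimes> z') = cent b"
proof -
  define d where "d = z \<otimes> z'"
  have dc: "d \<in> carrier G" using z z' by (simp add: d_def)
  have nc: "z \<notin> cent z'"
  proof
    assume "z \<in> cent z'"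
    then have "pt 1 \<in> cent x" using z z' cent_commute[of z "pt 1"] by simp
    then show False using not_commute_pt[OF not_dvd_1] cent_commute by simp
  qed
  \<comment> \<open>An element commuting with \<open>z\<close> commutes with the product exactly
    when it commutes with \<open>z'\<close>.\<close>
  have Wd: "cent d \<inter> cent x = W"
    using cent_prod[of _ z z'] z z' by (auto simp: W_def d_def)
  have "d \<notin> cent x"
  proof
    assume "d \<in> cent x"
    then have "z \<in> cent d" using z dc cent_commute[of d z] by simp
    then show False using cent_prod[OF self_mem_cent[OF z(1)] z(1) z'(1)] nc by (simp add: d_def)
  qed
  then have psub: "W \<subset> cent d" using Wd self_mem_cent[OF dc] by blast
  have d1: "d \<noteq> \<one>" using \<open>d \<notin> cent x\<close> subgroup.one_closed[OF subgroup_cent[OF x]] by blast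
  obtain u where u: "card (cent d) = card W * u"
    using card_subgroup_dvd[OF subgroup_W subgroup_cent[OF dc]] psub by blast
  have "card W < card (cent d)" using psub by (intro psubset_card_mono) auto
  then have u2: "2 \<le> u" using u by (cases u rule: nat.exhaust) (auto simp: Suc_le_eq)
  have total: "card (cls d) * card (cent d) = card (cls y) * p"
    using card_cls_cent[OF dc] card_cls_y by simp
  have h: "card (cls y) > 0" using card_cls_y_gt by simp
  consider "card (cls d) = p" | "card (cls d) = card (cls y)" | "card (cls d) > card (cls y)"
    using sizes[OF dc d1] by blast
  then show ?thesis
  proof cases
    case 1
    then have card_d: "card (cent d) = card (cls y)" using card_cent_if_card_cls dc by blast
    \<comment> \<open>The orbit of \<open>x\<close> under \<open>cent d\<close> has
      \<open>p - 1\<close> points. So \<open>cent d\<close> fixes the one point left over and, by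
      its order, is the whole stabilizer of that point.\<close>
    define T where "T = (\<lambda>g. cj g x) ` cent d"
    have "card T * card W = card (cent d)"
      unfolding T_def Wd[symmetric] by (rule card_orbit_cj) (simp_all add: subgroup_cent dc)
    then have "card T = p - 1" using card_d card_W card_W_pos by (metis mult_cancel2 less_not_refl)
    moreover have T_cls: "T \<subseteq> cls x" using cent_subset by (auto simp: T_def cls_def)
    ultimately have "card (cls x - T) = 1"
      using card_cls_x p_gt_1 finite_subset[OF T_cls] by (simp add: card_Diff_subset)
    then obtain b where b: "cls x - T = {b}" using card_1_singletonE by blast
    have bc: "b \<in> cls x" "b \<in> carrier G" using b mem_cls_carrier[of b x] by auto
    have "k \<in> cent b" if k: "k \<in> cent d" for k
    proof -
      have kc: "k \<in> carrier G" using k cent_subset by blast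
      have "cj k b \<notin> T"
      proof
        assume "cj k b \<in> T"
        then obtain g where g: "g \<in> cent d" "cj k b = cj g x" by (auto simp: T_def)
        then have gc: "g \<in> carrier G" using cent_subset by blast
        have "b = cj (inv k) (cj k b)" using kc bc by simp
        also have "\<dots> = cj (inv k \<otimes> g) x" unfolding g(2) using kc gc by (simp add: cj_mult)
        finally have "b \<in> T" using k g subgroup_cent[OF dc]
          by (auto simp: T_def subgroup.m_closed subgroup.m_inv_closed)
        then show False using b by blast
      qed
      then have "cj k b = b" using b cj_mem_cls[OF x kc bc(1)] by blast
      then show ?thesis using kc bc by (simp add: mem_cent_iff)
    qed
    then have "cent d \<subseteq> cent b" by blast
    moreover have "card (cent b) = card (cent d)"
      using card_d card_cent_if_card_cls[OF bc(2)] cls_eq[OF x bc(1)] card_cls_x by simp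
    ultimately have "cent d = cent b" by (intro card_subset_eq) auto
    then show ?thesis using bc unfolding d_def by blast
  next
    case 2
    then have "card (cent d) = p" using total h unfolding 2 by (metis mult_cancel1 less_not_refl)
    then have "card W dvd p" "card W \<noteq> p" using u \<open>card W < card (cent d)\<close> by auto
    then have "card W = 1" using prime_p unfolding prime_nat_iff by blast
    then show ?thesis using card_W_not_1 by simp
  next
    case 3
    \<comment> \<open>Modulo \<open>p\<close>, \<open>card (cls y)\<close> is congruent to
      \<open>e\<close> and, being \<open>(p - 1) * card W\<close>, to \<open>- card W\<close>. The
      bounds \<open>2 * card W < p\<close> and \<open>e < p\<close> leave
      \<open>card W + e = p\<close>. Then \<open>e\<close> is a divisor of \<open>p - 1\<close>
      above half of \<open>p\<close>, so \<open>e = p - 1\<close>.\<close>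
    define e where "e = card (cls y \<inter> P)"
    have e: "1 \<le> e" "e < p" "p dvd card (cls y) - e" "e < card (cls y)" "e dvd p - 1"
      using card_cls_y_cong card_Int_dvd unfolding e_def by auto
    have "card (cent d) < p"
    proof (rule ccontr)
      assume "\<not> card (cent d) < p"
      then have "card (cls y) * p < card (cls d) * card (cent d)"
        using 3 p_gt_1 by (intro mult_less_le_imp_less) auto
      then show False using total by simp
    qed
    moreover have "2 * card W \<le> card (cent d)" using u u2 by (simp add: mult.commute)
    ultimately have W2: "2 * card W < p" by simp
    have "p dvd (card (cls y) - e) + (card W + e)"
    proof -
      have "(card (cls y) - e) + (card W + e) = (p - 1) * card W + card W" using e(4) card_W by simp
      also have "\<dots> = p * card W" using p_gt_1 by (simp add: diff_mult_distrib)
      finally show ?thesis by simp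
    qed
    then have "p dvd card W + e" using e(3) by (simp add: dvd_add_right_iff)
    then obtain q where q: "card W + e = p * q" by blast
    have "q = 1"
    proof -
      have "p * q < p * 2" using q W2 e(2) by linarith
      then have "q < 2" by simp
      moreover have "q \<noteq> 0" using q e(1) by (intro notI) simp
      ultimately show ?thesis by simp
    qed
    then have We: "card W + e = p" using q by simp
    obtain r where r: "p - 1 = e * r" using e(5) by blast
    have "r = 1"
    proof (rule ccontr)
      assume "r \<noteq> 1"
      moreover have "r \<noteq> 0" using r p_gt_1 by (intro notI) simp
      ultimately have "2 \<le> r" by simp
      then have "e * 2 \<le> p - 1" unfolding r by (rule mult_le_mono2)
      then show False using We W2 p_gt_1 by linarith
    qed
    then have "card W = 1" using r We p_gt_1 by simp
    then show ?thesis using card_W_not_1 by simp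
  qed
qed

text \<open>Supplies the third composite size. Without it \<open>U\<close> is a normal subgroup
  containing \<open>x\<close>, so its order is not prime to \<open>p\<close>, the class size of
  \<open>x\<close>; but \<open>P\<close> moves every nontrivial element of \<open>U\<close>.\<close>

lemma sizes_not_restricted:
  "\<exists>g\<in>carrier G. g \<noteq> \<one> \<and> card (cls g) < card (cls y) \<and> card (cls g) \<noteq> p"
proof (rule ccontr)
  assume contr: "\<not> ?thesis"
  then have sizes: "card (cls g) = p \<or> card (cls g) = card (cls y) \<or> card (cls g) > card (cls y)"
    if "g \<in> carrier G" "g \<noteq> \<one>" for g using that by (meson nat_neq_iff)
  define U where "U = insert \<one> {z \<in> carrier G. \<exists>b\<in>cls x. cent z = cent b}"
  have U_carrier: "U \<subseteq> carrier G" by (auto simp: U_def)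
  have U_cj: "cj g z \<in> U" if g: "g \<in> carrier G" and z: "z \<in> U" for g z
  proof (cases "z = \<one>")
    case False
    then obtain b where b: "z \<in> carrier G" "b \<in> cls x" "cent z = cent b" using z by (auto simp: U_def)
    then have "cent (cj g z) = cent (cj g b)" using g mem_cls_carrier by (intro cent_eq_cj) auto
    then show ?thesis using b g cj_mem_cls[OF x g b(2)] by (auto simp: U_def)
  qed (use g in \<open>simp add: U_def\<close>)
  have U_mult: "z \<otimes> z' \<in> U" if zU: "z \<in> U" "z' \<in> U" for z z'
  proof (cases "z = \<one> \<or> z' = \<one> \<or> z \<otimes> z' = \<one>")
    case True
    then show ?thesis using zU U_carrier by (auto simp: U_def)
  next
    case False
    then obtain b b' where z: "z \<in> carrier G" "b \<in> cls x" "cent z = cent b"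
      and z': "z' \<in> carrier G" "b' \<in> cls x" "cent z' = cent b'"
      using zU by (auto simp: U_def)
    show ?thesis
    proof (cases "b = b'")
      case True
      \<comment> \<open>Both factors belong to the same point, and point stabilizers are maximal
        among the centralizers of nontrivial elements.\<close>
      then have "cent b \<subseteq> cent (z \<otimes> z')" using cent_prod[of _ z z'] z z' by auto
      then have "cent (z \<otimes> z') = cent b" using z z' False by (intro cent_eq_if_subset) auto
      then show ?thesis using z z' by (auto simp: U_def)
    next
      case ne: False
      obtain i i' where i: "b = pt i" "b' = pt i'" using cls_is_pt z z' by blast
      then have nd: "\<not> int p dvd i' - i" using ne pt_eq_iff[of i' i] by auto
      obtain g where g: "g \<in> cent x" "cj g (pt 1) = pt (i' - i)" using two_transitive[OF nd] by blast
      have gc: "g \<in> carrier G" "cj g x = x" using g by (auto simp: mem_cent_iff)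
      \<comment> \<open>\<open>v\<close> carries the pair \<open>x\<close>, \<open>pt 1\<close> to
        \<open>b\<close>, \<open>b'\<close>: \<open>g\<close> fixes \<open>x\<close> and adjusts the
        second point, then the shift by \<open>i\<close> moves both into place.\<close>
      define v where "v = y [^] i \<otimes> g"
      have vc: "v \<in> carrier G" using gc by (simp add: v_def)
      have vx: "cj v x = b" using gc i by (simp add: v_def cj_mult cj_pow_pt pt_def)
      have v1: "cj v (pt 1) = b'" using gc i g by (simp add: v_def cj_mult cj_pow_pt)
      have "cent (cj (inv v) z) = cent (cj (inv v) b)" "cent (cj (inv v) z') = cent (cj (inv v) b')"
        using cent_eq_cj[OF inv_closed[OF vc] z(1) mem_cls_carrier[OF z(2) x] z(3)]
          cent_eq_cj[OF inv_closed[OF vc] z'(1) mem_cls_carrier[OF z'(2) x] z'(3)] .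
      moreover have "cj (inv v) b = x" "cj (inv v) b' = pt 1"
        using cj_inv_left[OF vc x] cj_inv_left[OF vc pt_carrier, of 1] unfolding vx v1 .
      ultimately obtain c where c: "c \<in> cls x" "cent (cj (inv v) z \<otimes> cj (inv v) z') = cent c"
        using cent_prod_of_two_pts[OF sizes, of "cj (inv v) z" "cj (inv v) z'"] z z' vc by auto
      have "cj (inv v) z \<otimes> cj (inv v) z' \<in> U" using c z z' vc by (auto simp: U_def)
      then have "cj v (cj (inv v) z \<otimes> cj (inv v) z') \<in> U" by (rule U_cj[OF vc])
      then show ?thesis using z(1) z'(1) vc by (simp add: cj_prod)
    qed
  qed
  have sU: "subgroup U G"
    using U_carrier U_mult finite_subset_carrier by (intro subgroup_if_mult_closed) (auto simp: U_def)
  then have "U \<lhd> G" using U_cj by (simp add: normal_iff)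
  moreover have "x \<in> U" using self_mem_cls[OF x] by (auto simp: U_def)
  ultimately have "\<not> coprime (card U) p"
    using normal_not_coprime[of U x] x_not_one card_cls_x by auto
  then have dvd_U: "p dvd card U" using prime_p by (metis coprime_commute prime_imp_coprime)
  \<comment> \<open>Counting \<open>U\<close> by orbits of \<open>P\<close> makes \<open>p\<close>
    divide \<open>card U - 1\<close> as well as \<open>card U\<close>.\<close>
  have "p dvd card {z \<in> U. \<not> P \<subseteq> cent z}"
    using P_carrier U_cj finite_subset_carrier[OF U_carrier]
    by (intro dvd_card_nonfixed[OF P card_P prime_p _ U_carrier]) auto
  moreover have "{z \<in> U. \<not> P \<subseteq> cent z} = U - {\<one>}"
  proof -
    have "\<not> P \<subseteq> cent z" if z: "z \<in> U" "z \<noteq> \<one>" for z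
    proof -
      obtain b where "b \<in> cls x" "cent z = cent b" using z by (auto simp: U_def)
      then have "P \<inter> cent z = {\<one>}" using P_Int_cent by simp
      then show ?thesis using y by blast
    qed
    moreover have "P \<subseteq> cent \<one>" using P_carrier by (auto simp: cent_def)
    ultimately show ?thesis by blast
  qed
  moreover have "card (U - {\<one>}) = card U - 1"
    by (rule card_Diff_singleton) (simp add: U_def)
  ultimately have "p dvd card U - (card U - 1)" using dvd_U by (metis dvd_diff_nat)
  moreover have "card U > 0" using sU card_subgroup_pos by blast
  ultimately show False using p_gt_1 by simp
qed

end

section \<open>Composite class sizes of almost simple groups\<close>

lemma composite_iff: "composite n \<longleftrightarrow> n > 1 \<and> \<not> prime n"
proof (cases "n = 1")
  case False
  then show ?thesis unfolding composite_def prime_nat_iff by auto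
qed (auto simp: composite_def)

context finite_prime_group
begin

lemma prime_class_exists:
  assumes x: "x \<in> carrier G" and p: "prime (card (cls x))"
  shows "\<exists>P y. prime_class G (card (cls x)) x y P"
proof -
  let ?p = "card (cls x)"
  have "Coset.order G = ?p ^ 1 * card (cent x)"
    using card_cls_cent[OF x] by (simp add: Coset.order_def)
  then obtain P where P: "subgroup P G" "card P = ?p"
    using sylow_thm[OF p is_group _ finite_carrier, of 1] by auto
  have "P \<noteq> {\<one>}"
  proof
    assume "P = {\<one>}"
    then have "?p = 1" using P(2) by simp
    then show False using p by simp
  qed
  then obtain y where "y \<in> P" "y \<noteq> \<one>" using subgroup.one_closed[OF P(1)] by blast
  then have "prime_class G ?p x y P"
    by (intro prime_class.intro prime_class_axioms.intro finite_prime_group_axioms p x P refl)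
  then show ?thesis by blast
qed

text \<open>A prime class size is the least nontrivial class size, so two prime sizes bound each
  other.\<close>

lemma prime_card_cls_unique:
  assumes x: "x \<in> carrier G" "prime (card (cls x))" and x': "x' \<in> carrier G" "prime (card (cls x'))"
  shows "card (cls x) = card (cls x')"
proof -
  have "card (cls a) \<le> card (cls b)"
    if a: "a \<in> carrier G" "prime (card (cls a))" and b: "b \<in> carrier G" "prime (card (cls b))" for a b
  proof -
    obtain P y where pc: "prime_class G (card (cls a)) a y P" using prime_class_exists[OF a] by blast
    have "b \<noteq> \<one>" using b(2) card_cls_one by (intro notI) simp
    then show ?thesis by (rule prime_class.le_card_cls[OF pc b(1)])
  qed
  then show ?thesis using assms by (intro antisym)
qed

lemma card_composite_sizes: "card {n \<in> (\<lambda>g. card (cls g)) ` carrier G. composite n} \<noteq> 2"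
proof
  define C where "C = {n \<in> (\<lambda>g. card (cls g)) ` carrier G. composite n}"
  assume "card {n \<in> (\<lambda>g. card (cls g)) ` carrier G. composite n} = 2"
  then have C2: "card C = 2" by (simp add: C_def)
  have size: "prime (card (cls g)) \<or> card (cls g) \<in> C" if g: "g \<in> carrier G" "g \<noteq> \<one>" for g
    using card_cls_gt_1[OF g] g(1) by (auto simp: C_def composite_iff)
  show False
  proof (cases "\<exists>x\<in>carrier G. prime (card (cls x))")
    case True
    then obtain x where x0: "x \<in> carrier G" "prime (card (cls x))" by blast
    define p where "p = card (cls x)"
    obtain P y where "prime_class G p x y P" using prime_class_exists[OF x0] p_def by blast
    then interpret prime_class G p x y P .
    have uniq: "card (cls g) = p" if "g \<in> carrier G" "prime (card (cls g))" for g
      using prime_card_cls_unique[OF that x0] p_def by simp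
    \<comment> \<open>\<open>p\<close> is the only prime size, so every larger size is composite.
      For \<open>y\<close> and \<open>x \<otimes> y\<close> this exhausts \<open>C\<close>.\<close>
    have mem: "card (cls g) \<in> C" if g: "g \<in> carrier G" "card (cls g) > p" for g
    proof -
      have "\<not> prime (card (cls g))" using uniq[OF g(1)] g(2) by auto
      moreover have "card (cls g) > 1" using g(2) p_gt_1 by linarith
      ultimately show ?thesis using g(1) by (simp add: C_def composite_iff)
    qed
    have d: "card (cls (x \<otimes> y)) > card (cls y)"
      using coprime_p_card_cls_y card_cls_x by (intro card_cls_prod_gt x_not_one) simp_all
    have "{card (cls y), card (cls (x \<otimes> y))} \<subseteq> C"
      using mem[of y] mem[of "x \<otimes> y"] card_cls_y_gt d by simp
    moreover have "card {card (cls y), card (cls (x \<otimes> y))} = 2" using d by simp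
    moreover have "finite C" using C2 by (simp add: card_ge_0_finite)
    ultimately have C: "C = {card (cls y), card (cls (x \<otimes> y))}"
      using C2 by (metis card_subset_eq)
    obtain g where g: "g \<in> carrier G" "g \<noteq> \<one>" "card (cls g) < card (cls y)" "card (cls g) \<noteq> p"
      using sizes_not_restricted by blast
    then have "card (cls g) \<in> C" using size uniq by blast
    then show False using C g(3) d by auto
  next
    case False
    then have size': "card (cls g) \<in> C" if "g \<in> carrier G" "g \<noteq> \<one>" for g using size that by blast
    obtain m n where mn: "C = {m, n}" "m < n"
      using C2 by (metis card_2_iff insert_commute linorder_neqE_nat)
    have not_one: "g \<noteq> \<one>" if "card (cls g) \<in> C" for g
      using that card_cls_one by (intro notI) (simp add: C_def composite_iff)
    have "m \<in> C" "n \<in> C" using mn by auto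
    then obtain x y where "x \<in> carrier G" "y \<in> carrier G" "card (cls x) = m" "card (cls y) = n"
      by (auto simp: C_def)
    moreover from this have "x \<noteq> \<one>" "y \<noteq> \<one>" using not_one mn by auto
    ultimately show False using not_two_sizes[of m n x y] size' mn by auto
  qed
qed

end

text \<open>For almost simple \<open>G\<close>, \<open>\<gamma>\<close> is the embedding of \<open>S\<close> as the group of inner automorphisms and
  \<open>f n\<close> is the automorphism of \<open>S\<close> that \<open>n\<close> stands for.\<close>

lemma (in group) commuting_normal_subgroups_trivial:
  fixes S (structure)
  assumes S: "simple_group S" "\<not> comm_group S" and \<gamma>: "\<gamma> \<in> hom S G"
    and f: "\<And>n s. n \<in> carrier G \<Longrightarrow> s \<in> carrier S \<Longrightarrow> f n s \<in> carrier S"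
    and f_eq: "\<And>n s. n \<in> carrier G \<Longrightarrow> s \<in> carrier S \<Longrightarrow> n \<otimes>\<^bsub>G\<^esub> \<gamma> s = \<gamma> (f n s) \<otimes>\<^bsub>G\<^esub> n"
    and faithful: "\<And>n. n \<in> carrier G \<Longrightarrow> n \<noteq> \<one>\<^bsub>G\<^esub> \<Longrightarrow> \<exists>s\<in>carrier S. f n s \<noteq> s"
    and f_\<gamma>: "\<And>s t. s \<in> carrier S \<Longrightarrow> t \<in> carrier S \<Longrightarrow> f (\<gamma> s) t = s \<otimes>\<^bsub>S\<^esub> t \<otimes>\<^bsub>S\<^esub> inv\<^bsub>S\<^esub> s"
    and N: "N \<lhd> G" "M \<lhd> G" and comm: "\<And>a b. a \<in> N \<Longrightarrow> b \<in> M \<Longrightarrow> a \<otimes>\<^bsub>G\<^esub> b = b \<otimes>\<^bsub>G\<^esub> a"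
  shows "N = {\<one>\<^bsub>G\<^esub>} \<or> M = {\<one>\<^bsub>G\<^esub>}"
proof (rule ccontr)
  assume nontriv: "\<not> ?thesis"
  interpret S: simple_group S by (rule S(1))
  interpret \<gamma>: group_hom S G \<gamma> using \<gamma> by unfold_locales
  have preimage: "{s \<in> carrier S. \<gamma> s \<in> L} \<lhd> S" if L: "L \<lhd> G" for L
  proof -
    have sL: "subgroup L G" and nL: "\<And>g u. g \<in> carrier G \<Longrightarrow> u \<in> L \<Longrightarrow> cj g u \<in> L"
      using L by (auto simp: normal_iff)
    have "subgroup {s \<in> carrier S. \<gamma> s \<in> L} S"
      using subgroup.one_closed[OF sL] subgroup.m_closed[OF sL] subgroup.m_inv_closed[OF sL]
      by (intro S.subgroupI) auto
    moreover have "\<gamma> (S.cj s t) \<in> L" if "s \<in> carrier S" "t \<in> carrier S" "\<gamma> t \<in> L" for s t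
      using nL[of "\<gamma> s" "\<gamma> t"] that by (simp add: S.cj_def cj_def)
    ultimately show ?thesis by (auto simp: S.normal_iff)
  qed
  \<comment> \<open>If \<open>n\<close> in \<open>L\<close> moves \<open>t\<close>, the commutator
    of \<open>n\<close> and \<open>\<gamma> t\<close> lies in \<open>L\<close> and is the image of a
    nontrivial element of \<open>S\<close>. By simplicity the preimage of \<open>L\<close> is all of
    \<open>S\<close>.\<close>
  have contains: "\<gamma> s \<in> L" if L: "L \<lhd> G" "L \<noteq> {\<one>\<^bsub>G\<^esub>}" and s: "s \<in> carrier S" for L s
  proof -
    have sL: "subgroup L G" and nL: "\<And>g u. g \<in> carrier G \<Longrightarrow> u \<in> L \<Longrightarrow> cj g u \<in> L"
      using L by (auto simp: normal_iff)
    obtain n where n: "n \<in> L" "n \<noteq> \<one>\<^bsub>G\<^esub>" using L(2) subgroup.one_closed[OF sL] by blast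
    have nc: "n \<in> carrier G" using n sL subgroup.mem_carrier by metis
    obtain t where t: "t \<in> carrier S" "f n t \<noteq> t" using faithful[OF nc n(2)] by blast
    define u where "u = f n t \<otimes>\<^bsub>S\<^esub> inv\<^bsub>S\<^esub> t"
    have ft: "f n t \<in> carrier S" using f nc t by blast
    have "\<gamma> (f n t) = n \<otimes>\<^bsub>G\<^esub> \<gamma> t \<otimes>\<^bsub>G\<^esub> inv\<^bsub>G\<^esub> n"
      using f_eq[OF nc t(1)] nc t ft by (metis \<gamma>.hom_closed inv_solve_right m_closed)
    then have "\<gamma> u = n \<otimes>\<^bsub>G\<^esub> cj (\<gamma> t) (inv\<^bsub>G\<^esub> n)"
      using t ft nc by (simp add: u_def cj_def m_assoc)
    also have "\<dots> \<in> L"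
      using n t nc sL nL by (simp add: subgroup.m_closed subgroup.m_inv_closed)
    finally have uL: "u \<in> {s \<in> carrier S. \<gamma> s \<in> L}" using ft t by (simp add: u_def)
    have "u \<noteq> \<one>\<^bsub>S\<^esub>"
    proof
      assume "u = \<one>\<^bsub>S\<^esub>"
      then have "f n t = t" unfolding u_def using ft t(1) by (metis S.inv_solve_right S.l_one S.one_closed)
      then show False using t by simp
    qed
    then have "{s \<in> carrier S. \<gamma> s \<in> L} = carrier S"
      using S.no_real_normal_subgroup[OF preimage[OF L(1)]] uL by blast
    then show ?thesis using s by blast
  qed
  have \<gamma>_comm: "\<gamma> (s \<otimes>\<^bsub>S\<^esub> t) = \<gamma> (t \<otimes>\<^bsub>S\<^esub> s)" if "s \<in> carrier S" "t \<in> carrier S" for s t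
    using comm[of "\<gamma> s" "\<gamma> t"] contains N nontriv that by simp
  \<comment> \<open>The kernel of \<open>\<gamma>\<close> is everything or trivial. In the first
    case conjugation by \<open>s\<close> acts as conjugation by the identity; in the second,
    commuting images come from commuting elements. Both make \<open>S\<close> abelian.\<close>
  have "{\<one>\<^bsub>G\<^esub>} \<lhd> G" by (simp add: normal_iff triv_subgroup)
  from S.no_real_normal_subgroup[OF preimage[OF this]]
  have "s \<otimes>\<^bsub>S\<^esub> t = t \<otimes>\<^bsub>S\<^esub> s" if st: "s \<in> carrier S" "t \<in> carrier S" for s t
  proof
    assume "{s \<in> carrier S. \<gamma> s \<in> {\<one>\<^bsub>G\<^esub>}} = carrier S"
    then have "\<gamma> s = \<one>\<^bsub>G\<^esub>" "\<gamma> \<one>\<^bsub>S\<^esub> = \<one>\<^bsub>G\<^esub>" using st by auto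
    then have "s \<otimes>\<^bsub>S\<^esub> t \<otimes>\<^bsub>S\<^esub> inv\<^bsub>S\<^esub> s = t"
      using f_\<gamma>[OF st] f_\<gamma>[OF S.one_closed st(2)] st by simp
    then show ?thesis using st by (metis S.inv_solve_right S.m_closed)
  next
    assume ker: "{s \<in> carrier S. \<gamma> s \<in> {\<one>\<^bsub>G\<^esub>}} = {\<one>\<^bsub>S\<^esub>}"
    define u where "u = (s \<otimes>\<^bsub>S\<^esub> t) \<otimes>\<^bsub>S\<^esub> inv\<^bsub>S\<^esub> (t \<otimes>\<^bsub>S\<^esub> s)"
    have "\<gamma> u = \<gamma> (s \<otimes>\<^bsub>S\<^esub> t) \<otimes>\<^bsub>G\<^esub> inv\<^bsub>G\<^esub> \<gamma> (t \<otimes>\<^bsub>S\<^esub> s)"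
      unfolding u_def using st by (simp only: \<gamma>.hom_mult \<gamma>.hom_inv S.m_closed S.inv_closed)
    also have "\<dots> = \<one>\<^bsub>G\<^esub>" unfolding \<gamma>_comm[OF st] using st by simp
    finally have "\<gamma> u = \<one>\<^bsub>G\<^esub>" .
    moreover have "u \<in> carrier S" unfolding u_def using st by (intro S.m_closed S.inv_closed)
    ultimately have "u \<in> {s \<in> carrier S. \<gamma> s \<in> {\<one>\<^bsub>G\<^esub>}}" by blast
    then have "u = \<one>\<^bsub>S\<^esub>" unfolding ker by (rule singletonD)
    then show ?thesis unfolding u_def using st by (metis S.inv_solve_right S.l_one S.m_closed S.one_closed)
  qed
  then have "comm_group S" by (rule S.group_comm_groupI)
  then show False using S(2) by blast
qed

text \<open>The isomorphism \<open>h\<close> reads each element of \<open>G\<close> as an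
  automorphism of \<open>S\<close>, and \<open>\<gamma> s\<close> is the element acting as
  conjugation by \<open>s\<close>. Equations in \<open>G\<close> are checked by comparing actions on
  \<open>S\<close>.\<close>

lemma finite_prime_group_if_almost_simple:
  fixes G (structure)
  assumes G: "group G" "finite (carrier G)" and as: "almost_simple TYPE('b) G"
  shows "finite_prime_group G"
proof -
  interpret group G by (rule G(1))
  obtain S :: "'b monoid" and K where S: "simple_group S" "\<not> comm_group S"
    and K: "subgroup K (AutoGroup S)" "Inn S \<subseteq> K" and iso: "G \<cong> (AutoGroup S)\<lparr>carrier := K\<rparr>"
    using as unfolding almost_simple_def by blast
  interpret S: simple_group S by (rule S(1))
  obtain h where h: "h \<in> iso G ((AutoGroup S)\<lparr>carrier := K\<rparr>)" using iso by (auto simp: is_iso_def)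
  have bij: "bij_betw h (carrier G) K" using h by (simp add: iso_def)
  have K_Bij: "u \<in> Bij (carrier S)" "u \<in> hom S S" if "u \<in> K" for u
    using that subgroup.subset[OF K(1)] by (auto simp: AutoGroup_def auto_def)
  have h_K: "h n \<in> K" if "n \<in> carrier G" for n using that bij by (auto simp: bij_betw_def)
  have h_mult: "h (a \<otimes> b) s = h a (h b s)" if "a \<in> carrier G" "b \<in> carrier G" "s \<in> carrier S" for a b s
  proof -
    have "h (a \<otimes> b) = h a \<otimes>\<^bsub>AutoGroup S\<^esub> h b" using h that by (simp add: iso_def hom_def)
    then show ?thesis using that K_Bij h_K
      by (simp add: AutoGroup_def BijGroup_def compose_def)
  qed
  \<comment> \<open>Members of \<open>AutoGroup\<close> are extensional functions, so agreement on
    the carrier is equality.\<close>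
  have h_eqI: "a = b" if ab: "a \<in> carrier G" "b \<in> carrier G" "\<And>s. s \<in> carrier S \<Longrightarrow> h a s = h b s" for a b
  proof -
    have "h a = h b"
      using ab K_Bij(1)[OF h_K] by (intro extensionalityI[of _ "carrier S"]) (auto dest: Bij_imp_extensional)
    then show ?thesis using bij ab by (auto simp: bij_betw_def inj_on_def)
  qed
  have h_closed: "h n s \<in> carrier S" if "n \<in> carrier G" "s \<in> carrier S" for n s
    using K_Bij(2)[OF h_K] that by (auto simp: hom_def)
  have h_hom: "h n (s \<otimes>\<^bsub>S\<^esub> t) = h n s \<otimes>\<^bsub>S\<^esub> h n t"
    if "n \<in> carrier G" "s \<in> carrier S" "t \<in> carrier S" for n s t
    using K_Bij(2)[OF h_K] that by (auto simp: hom_def)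
  have h_inv: "h n (inv\<^bsub>S\<^esub> s) = inv\<^bsub>S\<^esub> (h n s)" if "n \<in> carrier G" "s \<in> carrier S" for n s
    using group_hom.hom_inv[of S S "h n" s] K_Bij(2)[OF h_K] that
    by (simp add: group_hom_def group_hom_axioms_def S.is_group)
  define \<gamma> where "\<gamma> s = inv_into (carrier G) h (conj_by S s)" for s
  have \<gamma>_closed: "\<gamma> s \<in> carrier G" and h_\<gamma>: "h (\<gamma> s) = conj_by S s" if s: "s \<in> carrier S" for s
  proof -
    have "conj_by S s \<in> h ` carrier G" using K(2) s bij by (auto simp: Inn_def bij_betw_def)
    then show "\<gamma> s \<in> carrier G" "h (\<gamma> s) = conj_by S s"
      unfolding \<gamma>_def by (auto intro: inv_into_into f_inv_into_f)
  qed
  have h_\<gamma>_app: "h (\<gamma> s) t = s \<otimes>\<^bsub>S\<^esub> t \<otimes>\<^bsub>S\<^esub> inv\<^bsub>S\<^esub> s" if "s \<in> carrier S" "t \<in> carrier S" for s t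
    using that h_\<gamma> by (simp add: conj_by_def)
  \<comment> \<open>\<open>h \<one>\<close> is idempotent and injective on the carrier.\<close>
  have "h \<one> s = s" if s: "s \<in> carrier S" for s
  proof -
    have "h \<one> (h \<one> s) = h \<one> s" using h_mult[of \<one> \<one> s] s by simp
    moreover have "inj_on (h \<one>) (carrier S)" using K_Bij(1)[OF h_K] by (auto simp: Bij_def bij_betw_def)
    ultimately show ?thesis using s h_closed[OF one_closed s] by (auto simp: inj_on_def)
  qed
  note h_one = this
  show ?thesis
  proof (intro finite_prime_group.intro finite_prime_group_axioms.intro G)
    fix N M assume NM: "N \<lhd> G" "M \<lhd> G" "\<And>a b. a \<in> N \<Longrightarrow> b \<in> M \<Longrightarrow> a \<otimes> b = b \<otimes> a"
    show "N = {\<one>} \<or> M = {\<one>}"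
    proof (rule commuting_normal_subgroups_trivial[where f = h and \<gamma> = \<gamma>, OF S _ h_closed _ _ h_\<gamma>_app NM])
      show "\<gamma> \<in> hom S G"
      proof (rule homI)
        fix s t assume st: "s \<in> carrier S" "t \<in> carrier S"
        show "\<gamma> (s \<otimes>\<^bsub>S\<^esub> t) = \<gamma> s \<otimes> \<gamma> t"
          using st \<gamma>_closed
          by (intro h_eqI) (simp_all add: h_mult h_\<gamma>_app S.m_assoc S.inv_mult_group)
      qed (rule \<gamma>_closed)
      show "n \<otimes> \<gamma> s = \<gamma> (h n s) \<otimes> n" if ns: "n \<in> carrier G" "s \<in> carrier S" for n s
        using ns \<gamma>_closed h_closed
        by (intro h_eqI) (simp_all add: h_mult h_\<gamma>_app h_hom h_inv)
      show "\<exists>s\<in>carrier S. h n s \<noteq> s" if n: "n \<in> carrier G" "n \<noteq> \<one>" for n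
        using n h_eqI[of n \<one>] h_one by auto
    qed
  qed
qed

theorem proposition3p1:
  fixes G :: "('a, 'm) monoid_scheme"
  assumes "group G"
    and "finite (carrier G)"
    and "card {n \<in> cs G. composite n} = 2"
  shows "\<not> almost_simple TYPE('b) G"
proof
  assume "almost_simple TYPE('b) G"
  then interpret finite_prime_group G
    by (rule finite_prime_group_if_almost_simple[OF assms(1,2)])
  have "conj_class G x = cls x" if "x \<in> carrier G" for x
    using that by (auto simp: conj_class_def orbit_def conj_by_def cls_def cj_def)
  then have "cs G = (\<lambda>g. card (cls g)) ` carrier G"
    unfolding cs_def Setcompr_eq_image by (intro image_cong) simp_all
  then show False using card_composite_sizes assms(3) by simp
qed

end
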